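(* Let $(G_k)_{k\in\mathbb N}$ be a sequence of groups all containing a common subgroup $H$, and let $K$ be a sofic group. If the sequence $(H<G_k)_{k\in\mathbb N}$ is consistently relatively sofic over $K$, then the amalgamated free product $\ast^{k\in\mathbb N}_H G_k$ of all the $G_k$ over the common subgroup $H$ is sofic.
   Context: The sequence $(H<G_k)$ is consistently relatively sofic over $K$ if there exist a sequence of inclusions of groups $(H_i<L_i)_{i\in\mathbb N}$ with all $L_i$ sofic and all $H_i$ amenable, a free ultrafilter $\omega$ on $\mathbb N$, and embeddings $\pi_k:G_k\to\prod_\omega(L_i\times K)$ into the algebraic ultraproduct such that (1) $\pi_k(G_k)\cap\prod_\omega(H_i\times K)=\pi_k(H)$ for all $k$, and (2) for every $h\in H$, $\pi_k(h)$ is independent of $k$. The algebraic ultraproduct is $\prod_\omega M_i=(\prod_i M_i)/N$ with $N=\{(g_i):\{i:g_i=1\}\in\omega\}$. *)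

theory Defs
  imports "HOL-Algebra.Algebra" "HOL-Combinatorics.Permutations"
begin

definition hamming :: "nat \<Rightarrow> (nat \<Rightarrow> nat) \<Rightarrow> (nat \<Rightarrow> nat) \<Rightarrow> real" where
  "hamming n \<sigma> \<tau> = real (card {x \<in> {..<n}. \<sigma> x \<noteq> \<tau> x}) / real n"

definition sofic :: "('g, 'm) monoid_scheme \<Rightarrow> bool" where
  "sofic \<Gamma> \<longleftrightarrow> group \<Gamma> \<and>
     (\<forall>F (\<epsilon>::real). finite F \<and> F \<subseteq> carrier \<Gamma> \<and> \<epsilon> > 0 \<longrightarrow>
        (\<exists>n::nat. n > 0 \<and> (\<exists>\<phi>. (\<forall>g \<in> carrier \<Gamma>. \<phi> g permutes {..<n})
           \<and> (\<forall>g \<in> F. \<forall>h \<in> F. hamming n (\<phi> (g \<otimes>\<^bsub>\<Gamma>\<^esub> h)) (\<phi> g \<circ> \<phi> h) < \<epsilon>)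
           \<and> (\<forall>g \<in> F. g \<noteq> \<one>\<^bsub>\<Gamma>\<^esub> \<longrightarrow> hamming n (\<phi> g) id > 1 - \<epsilon>))))"

definition amenable :: "('g, 'm) monoid_scheme \<Rightarrow> bool" where
  "amenable \<Gamma> \<longleftrightarrow> group \<Gamma> \<and>
     (\<forall>F (\<epsilon>::real). finite F \<and> F \<subseteq> carrier \<Gamma> \<and> \<epsilon> > 0 \<longrightarrow>
        (\<exists>A. finite A \<and> A \<noteq> {} \<and> A \<subseteq> carrier \<Gamma> \<and>
           (\<forall>g \<in> F. real (card (((g <#\<^bsub>\<Gamma>\<^esub> A) - A) \<union> (A - (g <#\<^bsub>\<Gamma>\<^esub> A))))
                       < \<epsilon> * real (card A))))"

definition free_ultrafilter :: "nat set set \<Rightarrow> bool" where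
  "free_ultrafilter U \<longleftrightarrow> UNIV \<in> U \<and> {} \<notin> U
     \<and> (\<forall>A B. A \<in> U \<longrightarrow> B \<in> U \<longrightarrow> A \<inter> B \<in> U)
     \<and> (\<forall>A B. A \<in> U \<longrightarrow> A \<subseteq> B \<longrightarrow> B \<in> U)
     \<and> (\<forall>A. A \<in> U \<or> - A \<in> U)
     \<and> (\<forall>A. finite A \<longrightarrow> A \<notin> U)"

abbreviation fullprod :: "(nat \<Rightarrow> ('a, 'm) monoid_scheme) \<Rightarrow> (nat \<Rightarrow> 'a) monoid" where
  "fullprod M \<equiv> product_group UNIV M"

definition ultra_kernel :: "nat set set \<Rightarrow> (nat \<Rightarrow> ('a, 'm) monoid_scheme) \<Rightarrow> (nat \<Rightarrow> 'a) set" where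
  "ultra_kernel U M = {x \<in> carrier (fullprod M). {i. x i = \<one>\<^bsub>M i\<^esub>} \<in> U}"

definition ultraproduct :: "nat set set \<Rightarrow> (nat \<Rightarrow> ('a, 'm) monoid_scheme) \<Rightarrow> (nat \<Rightarrow> 'a) set monoid" where
  "ultraproduct U M = fullprod M Mod ultra_kernel U M"

definition ultra_subproduct :: "nat set set \<Rightarrow> (nat \<Rightarrow> ('a, 'm) monoid_scheme) \<Rightarrow> (nat \<Rightarrow> 'a set)
    \<Rightarrow> (nat \<Rightarrow> 'a) set set" where
  "ultra_subproduct U M S =
     {ultra_kernel U M #>\<^bsub>fullprod M\<^esub> x | x. x \<in> carrier (fullprod M) \<and> (\<forall>i. x i \<in> S i)}"

text \<open>The type 'b of the carriers of the groups L_i is an explicit parameter; a free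
  type variable in a hypothesis of a theorem is universally quantified, which amounts
  to existential quantification over the type of the witnesses.\<close>
definition consistently_relatively_sofic ::
  "'b itself \<Rightarrow> (nat \<Rightarrow> ('a, 'm) monoid_scheme) \<Rightarrow> 'a set \<Rightarrow> ('c, 'n) monoid_scheme \<Rightarrow> bool" where
  "consistently_relatively_sofic _ G H K \<longleftrightarrow>
    (\<exists>(L :: nat \<Rightarrow> 'b monoid) (Hs :: nat \<Rightarrow> 'b set) U
      (\<pi> :: nat \<Rightarrow> 'a \<Rightarrow> (nat \<Rightarrow> 'b \<times> 'c) set).
       (\<forall>i. sofic (L i) \<and> subgroup (Hs i) (L i) \<and> amenable ((L i)\<lparr>carrier := Hs i\<rparr>))
     \<and> free_ultrafilter U
     \<and> (\<forall>k. \<pi> k \<in> hom (G k) (ultraproduct U (\<lambda>i. L i \<times>\<times> K))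
            \<and> inj_on (\<pi> k) (carrier (G k)))
     \<and> (\<forall>k. \<pi> k ` carrier (G k) \<inter> ultra_subproduct U (\<lambda>i. L i \<times>\<times> K) (\<lambda>i. Hs i \<times> carrier K)
            = \<pi> k ` H)
     \<and> (\<forall>h \<in> H. \<forall>k k'. \<pi> k h = \<pi> k' h))"

definition amal_word :: "(nat \<Rightarrow> ('a, 'm) monoid_scheme) \<Rightarrow> (nat \<times> 'a) list \<Rightarrow> bool" where
  "amal_word G w \<longleftrightarrow> (\<forall>(k, g) \<in> set w. g \<in> carrier (G k))"

inductive amal_rel :: "(nat \<Rightarrow> ('a, 'm) monoid_scheme) \<Rightarrow> 'a set
    \<Rightarrow> (nat \<times> 'a) list \<Rightarrow> (nat \<times> 'a) list \<Rightarrow> bool"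
  for G H where
  refl: "amal_word G w \<Longrightarrow> amal_rel G H w w"
| sym: "amal_rel G H u v \<Longrightarrow> amal_rel G H v u"
| trans: "amal_rel G H u v \<Longrightarrow> amal_rel G H v w \<Longrightarrow> amal_rel G H u w"
| cong: "amal_rel G H u v \<Longrightarrow> amal_word G x \<Longrightarrow> amal_word G y
          \<Longrightarrow> amal_rel G H (x @ u @ y) (x @ v @ y)"
| mult: "g \<in> carrier (G k) \<Longrightarrow> h \<in> carrier (G k)
          \<Longrightarrow> amal_rel G H [(k, g), (k, h)] [(k, g \<otimes>\<^bsub>G k\<^esub> h)]"
| unit: "amal_rel G H [(k, \<one>\<^bsub>G k\<^esub>)] []"
| amalg: "h \<in> H \<Longrightarrow> amal_rel G H [(k, h)] [(k', h)]"

definition amal_class :: "(nat \<Rightarrow> ('a, 'm) monoid_scheme) \<Rightarrow> 'a set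
    \<Rightarrow> (nat \<times> 'a) list \<Rightarrow> (nat \<times> 'a) list set" where
  "amal_class G H w = {v. amal_rel G H w v}"

definition amalgam :: "(nat \<Rightarrow> ('a, 'm) monoid_scheme) \<Rightarrow> 'a set \<Rightarrow> (nat \<times> 'a) list set monoid" where
  "amalgam G H = \<lparr>carrier = {amal_class G H w | w. amal_word G w},
     monoid.mult = (\<lambda>A B. amal_class G H ((SOME a. a \<in> A) @ (SOME b. b \<in> B))),
     one = amal_class G H []\<rparr>"

end

theory Submission
  imports Defs
begin

text \<open>
  Let \<open>\<sigma>\<close> be a sofic approximation of \<open>L\<close> on a finite set and let \<open>T\<close> be a Folner set of the
  amenable subgroup \<open>S\<close> of \<open>L\<close>. Order the points at random and let the tile of \<open>a\<close> be the smallest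
  point among \<open>\<sigma>(t\<^sup>-\<^sup>1) a\<close>, \<open>t \<in> T\<close>. Invariance of \<open>T\<close> shows that elements of \<open>S\<close> preserve most
  tiles, while freeness of \<open>\<sigma>\<close> shows that elements outside \<open>S\<close> change most tiles; multiplying with a
  sofic approximation of \<open>K\<close> gives the same for \<open>S \<times> K\<close> inside \<open>L \<times> K\<close>.

  Now let \<open>C\<close> be a finite set with involutions \<open>\<rho>(k, b)\<close>, indexed by factors and tiles, that satisfy
  no short relation except the involution law. Twisting \<open>\<sigma>\<close> on the \<open>k\<close>-th factor by the involution
  that acts on the fibre \<open>C\<close> over \<open>a\<close> as \<open>\<rho>(k, tile a)\<close> makes the factors agree on \<open>S \<times> K\<close> and
  otherwise independent, so a reduced word of the amalgam moves almost every point.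
  Since the embeddings into the ultraproduct are determined on finitely many elements by a single
  coordinate, these actions are sofic approximations of the amalgam.
\<close>

section \<open>Proportions in finite sets and sofic approximations\<close>

text \<open>The uniform probability of an event on a finite set. Division by zero gives the value 0
  on the empty set, which is why \<open>freq_not\<close> asks for \<open>Z\<close> to be
  nonempty.\<close>

definition freq :: "'z set \<Rightarrow> ('z \<Rightarrow> bool) \<Rightarrow> real" where
  "freq Z P = real (card {x \<in> Z. P x}) / real (card Z)"

lemma freq_mono:
  assumes "finite Z" "\<And>x. x \<in> Z \<Longrightarrow> P x \<Longrightarrow> Q x"
  shows "freq Z P \<le> freq Z Q"
  unfolding freq_def using assms by (intro divide_right_mono of_nat_mono card_mono) auto

lemma freq_cong: "(\<And>x. x \<in> Z \<Longrightarrow> P x = Q x) \<Longrightarrow> freq Z P = freq Z Q"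
  unfolding freq_def by (metis (mono_tags, lifting) Collect_cong)

lemma freq_False: "(\<And>x. x \<in> Z \<Longrightarrow> \<not> P x) \<Longrightarrow> freq Z P = 0"
  unfolding freq_def by (simp add: conj_commute cong: conj_cong)

lemma freq_disj:
  assumes "finite Z"
  shows "freq Z (\<lambda>x. P x \<or> Q x) \<le> freq Z P + freq Z Q"
proof -
  have "{x \<in> Z. P x \<or> Q x} = {x \<in> Z. P x} \<union> {x \<in> Z. Q x}" by auto
  then have "card {x \<in> Z. P x \<or> Q x} \<le> card {x \<in> Z. P x} + card {x \<in> Z. Q x}"
    by (metis card_Un_le)
  then show ?thesis
    unfolding freq_def add_divide_distrib[symmetric] by (intro divide_right_mono) linarith+
qed

lemma freq_bex:
  assumes "finite Z" "finite I" "\<And>i. i \<in> I \<Longrightarrow> freq Z (P i) \<le> \<epsilon>"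
  shows "freq Z (\<lambda>x. \<exists>i\<in>I. P i x) \<le> real (card I) * \<epsilon>"
  using assms(2,3)
proof (induction I rule: finite_induct)
  case empty
  then show ?case by (simp add: freq_False)
next
  case (insert j I)
  have "freq Z (\<lambda>x. \<exists>i\<in>insert j I. P i x) \<le> freq Z (P j) + freq Z (\<lambda>x. \<exists>i\<in>I. P i x)"
    using freq_disj[OF assms(1), of "P j"] by simp
  with insert show ?case by (fastforce simp: algebra_simps)
qed

lemma freq_not:
  assumes "finite Z" "Z \<noteq> {}"
  shows "freq Z (\<lambda>x. \<not> P x) = 1 - freq Z P"
proof -
  have "card {x \<in> Z. P x} + card {x \<in> Z. \<not> P x} = card Z"
    using assms(1) by (subst card_Un_disjoint[symmetric]) (auto intro: arg_cong[where f = card])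
  then have "real (card {x \<in> Z. \<not> P x}) = real (card Z) - real (card {x \<in> Z. P x})" by linarith
  then show ?thesis using assms by (simp add: freq_def field_simps)
qed

lemma freq_bij_betw:
  assumes "bij_betw f Z Y"
  shows "freq Z (\<lambda>x. P (f x)) = freq Y P"
proof -
  have "bij_betw f {x \<in> Z. P (f x)} {y \<in> Y. P y}"
    using assms unfolding bij_betw_def by (auto intro: inj_on_subset)
  then show ?thesis unfolding freq_def using assms by (simp add: bij_betw_same_card)
qed

text \<open>Fubini for the counting measure: a bound in each fibre is a bound on the product. Below,
  the fibre consists of random orderings, so a probability estimate at each point becomes a count on
  one finite set.\<close>

lemma freq_Times_le:
  assumes "finite Z" "finite Y" "\<epsilon> \<ge> 0" "\<And>z. z \<in> Z \<Longrightarrow> freq Y (P z) \<le> \<epsilon>"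
  shows "freq (Z \<times> Y) (\<lambda>p. P (fst p) (snd p)) \<le> \<epsilon>"
proof -
  have le: "real (card {y \<in> Y. P z y}) \<le> \<epsilon> * card Y" if "z \<in> Z" for z
  proof (cases "Y = {}")
    case False
    then have "card Y > 0" using assms(2) by (simp add: card_gt_0_iff)
    then show ?thesis using assms(4)[OF that] by (simp add: freq_def divide_le_eq)
  qed simp
  have "{p \<in> Z \<times> Y. P (fst p) (snd p)} = (SIGMA z:Z. {y \<in> Y. P z y})" by auto
  then have "real (card {p \<in> Z \<times> Y. P (fst p) (snd p)}) = (\<Sum>z\<in>Z. real (card {y \<in> Y. P z y}))"
    using assms by (simp add: card_SigmaI)
  also have "\<dots> \<le> (\<Sum>z\<in>Z. \<epsilon> * card Y)" by (intro sum_mono le)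
  also have "\<dots> = \<epsilon> * card (Z \<times> Y)" by (simp add: card_cartesian_product)
  finally show ?thesis
    using assms(3) unfolding freq_def
    by (cases "card (Z \<times> Y) = 0") (simp, simp only: divide_le_eq of_nat_0_less_iff, simp)
qed

lemma freq_Times_fst:
  assumes "finite Y" "Y \<noteq> {}"
  shows "freq (Z \<times> Y) (\<lambda>p. P (fst p)) = freq Z P"
proof -
  have "{p \<in> Z \<times> Y. P (fst p)} = {z \<in> Z. P z} \<times> Y" by auto
  then show ?thesis using assms by (simp add: freq_def card_cartesian_product)
qed

lemma freq_Times_snd:
  assumes "finite Z" "Z \<noteq> {}"
  shows "freq (Z \<times> Y) (\<lambda>p. P (snd p)) = freq Y P"
proof -
  have "{p \<in> Z \<times> Y. P (snd p)} = Z \<times> {y \<in> Y. P y}" by auto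
  then show ?thesis using assms by (simp add: freq_def card_cartesian_product)
qed

section \<open>Sofic groups and finite models\<close>

lemma hamming_eq_freq: "hamming n \<sigma> \<tau> = freq {..<n} (\<lambda>x. \<sigma> x \<noteq> \<tau> x)"
  by (simp add: hamming_def freq_def)

text \<open>An enumeration of \<open>Z\<close> conjugates the model to \<open>{..<n}\<close>, and
  proportions are invariant under this bijection. Later constructions can therefore use product sets
  directly.\<close>

lemma soficI_finite_models:
  fixes \<Gamma> :: "('g, 'm) monoid_scheme"
  assumes "group \<Gamma>"
    and model: "\<And>F \<epsilon>. finite F \<Longrightarrow> F \<subseteq> carrier \<Gamma> \<Longrightarrow> (\<epsilon>::real) > 0 \<Longrightarrow>
      \<exists>(Z :: 'z set) \<phi>. finite Z \<and> Z \<noteq> {} \<and> (\<forall>g\<in>carrier \<Gamma>. bij_betw (\<phi> g) Z Z)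
        \<and> (\<forall>g\<in>F. \<forall>h\<in>F. freq Z (\<lambda>x. \<phi> (g \<otimes>\<^bsub>\<Gamma>\<^esub> h) x \<noteq> \<phi> g (\<phi> h x)) < \<epsilon>)
        \<and> (\<forall>g\<in>F. g \<noteq> \<one>\<^bsub>\<Gamma>\<^esub> \<longrightarrow> freq Z (\<lambda>x. \<phi> g x = x) < \<epsilon>)"
  shows "sofic \<Gamma>"
  unfolding sofic_def
proof (intro conjI allI impI)
  fix F and \<epsilon> :: real
  assume F: "finite F \<and> F \<subseteq> carrier \<Gamma> \<and> \<epsilon> > 0"
  then obtain Z :: "'z set" and \<phi> where Z: "finite Z" "Z \<noteq> {}"
    and bij: "\<And>g. g \<in> carrier \<Gamma> \<Longrightarrow> bij_betw (\<phi> g) Z Z"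
    and mul: "\<And>g h. g \<in> F \<Longrightarrow> h \<in> F \<Longrightarrow> freq Z (\<lambda>x. \<phi> (g \<otimes>\<^bsub>\<Gamma>\<^esub> h) x \<noteq> \<phi> g (\<phi> h x)) < \<epsilon>"
    and free: "\<And>g. g \<in> F \<Longrightarrow> g \<noteq> \<one>\<^bsub>\<Gamma>\<^esub> \<Longrightarrow> freq Z (\<lambda>x. \<phi> g x = x) < \<epsilon>"
    using model[of F \<epsilon>] by blast
  interpret group \<Gamma> by fact
  define n where "n = card Z"
  have "n > 0" using Z by (simp add: n_def card_gt_0_iff)
  obtain e where e: "bij_betw e {..<n} Z"
    using ex_bij_betw_nat_finite[OF Z(1)] unfolding n_def atLeast0LessThan by blast
  define d where "d = the_inv_into {..<n} e"
  have d: "bij_betw d Z {..<n}" unfolding d_def by (rule bij_betw_the_inv_into[OF e])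
  have ed: "e (d z) = z" if "z \<in> Z" for z
    unfolding d_def using e that by (simp add: f_the_inv_into_f_bij_betw)
  have de: "d (e x) = x" if "x < n" for x
    unfolding d_def using e that by (simp add: the_inv_into_f_f bij_betw_def)
  have eZ: "e x \<in> Z" if "x < n" for x using e that by (auto simp: bij_betw_def)
  have d_inj: "d z = d z' \<longleftrightarrow> z = z'" if "z \<in> Z" "z' \<in> Z" for z z' using that ed by metis
  \<comment> \<open>The second branch is there because \<open>permutes\<close> demands the identity
    outside \<open>{..<n}\<close>.\<close>
  define \<psi> where "\<psi> g x = (if x < n then d (\<phi> g (e x)) else x)" for g x
  have \<phi>Z: "\<phi> g z \<in> Z" if "g \<in> carrier \<Gamma>" "z \<in> Z" for g z
    using bij that by (auto simp: bij_betw_def)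
  have perm: "\<psi> g permutes {..<n}" if "g \<in> carrier \<Gamma>" for g
  proof (rule bij_imp_permutes)
    have "bij_betw (d \<circ> (\<phi> g \<circ> e)) {..<n} {..<n}"
      using bij_betw_trans[OF bij_betw_trans[OF e bij[OF that]] d] by simp
    then show "bij_betw (\<psi> g) {..<n} {..<n}"
      by (rule bij_betw_cong[THEN iffD1, rotated]) (simp add: \<psi>_def)
  qed (auto simp: \<psi>_def)
  have "hamming n (\<psi> (g \<otimes>\<^bsub>\<Gamma>\<^esub> h)) (\<psi> g \<circ> \<psi> h) < \<epsilon>" if "g \<in> F" "h \<in> F" for g h
  proof -
    have gh: "g \<in> carrier \<Gamma>" "h \<in> carrier \<Gamma>" using F that by auto
    have lt: "d z < n" if "z \<in> Z" for z using d that by (auto simp: bij_betw_def)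
    have "hamming n (\<psi> (g \<otimes>\<^bsub>\<Gamma>\<^esub> h)) (\<psi> g \<circ> \<psi> h)
        = freq {..<n} (\<lambda>x. \<phi> (g \<otimes>\<^bsub>\<Gamma>\<^esub> h) (e x) \<noteq> \<phi> g (\<phi> h (e x)))"
      unfolding hamming_eq_freq
      using gh by (intro freq_cong) (simp add: \<psi>_def eZ ed \<phi>Z lt d_inj)
    also have "\<dots> = freq Z (\<lambda>x. \<phi> (g \<otimes>\<^bsub>\<Gamma>\<^esub> h) x \<noteq> \<phi> g (\<phi> h x))"
      by (rule freq_bij_betw[OF e])
    finally show ?thesis using mul that by simp
  qed
  moreover have "hamming n (\<psi> g) id > 1 - \<epsilon>" if "g \<in> F" "g \<noteq> \<one>\<^bsub>\<Gamma>\<^esub>" for g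
  proof -
    have g: "g \<in> carrier \<Gamma>" using F that by auto
    have "hamming n (\<psi> g) id = freq {..<n} (\<lambda>x. \<phi> g (e x) \<noteq> e x)"
      unfolding hamming_eq_freq
    proof (intro freq_cong)
      fix x assume "x \<in> {..<n}"
      then show "(\<psi> g x \<noteq> id x) = (\<phi> g (e x) \<noteq> e x)"
        using d_inj[OF \<phi>Z[OF g eZ] eZ, of x x] by (simp add: \<psi>_def de)
    qed
    also have "\<dots> = freq Z (\<lambda>x. \<phi> g x \<noteq> x)" by (rule freq_bij_betw[OF e])
    also have "\<dots> = 1 - freq Z (\<lambda>x. \<phi> g x = x)" by (rule freq_not[OF Z])
    finally show ?thesis using free[OF that] by simp
  qed
  ultimately show "\<exists>n>0. \<exists>\<phi>. (\<forall>g\<in>carrier \<Gamma>. \<phi> g permutes {..<n})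
      \<and> (\<forall>g\<in>F. \<forall>h\<in>F. hamming n (\<phi> (g \<otimes>\<^bsub>\<Gamma>\<^esub> h)) (\<phi> g \<circ> \<phi> h) < \<epsilon>)
      \<and> (\<forall>g\<in>F. g \<noteq> \<one>\<^bsub>\<Gamma>\<^esub> \<longrightarrow> 1 - \<epsilon> < hamming n (\<phi> g) id)"
    using \<open>n > 0\<close> perm by blast
qed fact

text \<open>Distinct elements \<open>g\<close> and \<open>h\<close> are compared through
  \<open>k\<close>, the product of the inverse of \<open>h\<close> with \<open>g\<close>. If
  \<open>\<sigma> g a = \<sigma> h a\<close> and \<open>\<sigma>\<close> respects the product of
  \<open>h\<close> and \<open>k\<close> at \<open>a\<close>, then injectivity of
  \<open>\<sigma> h\<close> makes \<open>a\<close> a fixed point of \<open>\<sigma> k\<close>. Hence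
  these quotients are added to \<open>F\<close> and both errors are halved.\<close>

lemma sofic_separating:
  assumes "sofic L" "finite F" "F \<subseteq> carrier L" "(\<epsilon>::real) > 0"
  obtains n \<sigma> where "n > 0" "\<And>g. g \<in> carrier L \<Longrightarrow> bij_betw (\<sigma> g) {..<n::nat} {..<n}"
    "\<And>g h. g \<in> F \<Longrightarrow> h \<in> F \<Longrightarrow> freq {..<n} (\<lambda>a. \<sigma> (g \<otimes>\<^bsub>L\<^esub> h) a \<noteq> \<sigma> g (\<sigma> h a)) \<le> \<epsilon>"
    "\<And>g h. g \<in> F \<Longrightarrow> h \<in> F \<Longrightarrow> g \<noteq> h \<Longrightarrow> freq {..<n} (\<lambda>a. \<sigma> g a = \<sigma> h a) \<le> \<epsilon>"
    "\<And>g. g \<in> F \<Longrightarrow> g \<noteq> \<one>\<^bsub>L\<^esub> \<Longrightarrow> freq {..<n} (\<lambda>a. \<sigma> g a = a) \<le> \<epsilon>"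
proof -
  interpret group L using assms by (simp add: sofic_def)
  define F' where "F' = F \<union> (\<lambda>(x, y). inv\<^bsub>L\<^esub> y \<otimes>\<^bsub>L\<^esub> x) ` (F \<times> F)"
  have F': "finite F' \<and> F' \<subseteq> carrier L \<and> \<epsilon> / 2 > 0"
    using assms unfolding F'_def by auto
  obtain n \<sigma> where n: "n > 0" and perm: "\<forall>g\<in>carrier L. \<sigma> g permutes {..<n}"
    and mul: "\<forall>g\<in>F'. \<forall>h\<in>F'. hamming n (\<sigma> (g \<otimes>\<^bsub>L\<^esub> h)) (\<sigma> g \<circ> \<sigma> h) < \<epsilon> / 2"
    and free: "\<forall>g\<in>F'. g \<noteq> \<one>\<^bsub>L\<^esub> \<longrightarrow> hamming n (\<sigma> g) id > 1 - \<epsilon> / 2"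
    using assms(1)[unfolded sofic_def, THEN conjunct2, THEN spec, THEN spec, THEN mp, OF F'] by blast
  have free': "freq {..<n} (\<lambda>a. \<sigma> g a = a) \<le> \<epsilon> / 2" if "g \<in> F'" "g \<noteq> \<one>\<^bsub>L\<^esub>" for g
    using free that n freq_not[of "{..<n}" "\<lambda>a. \<sigma> g a = a"] unfolding hamming_eq_freq by fastforce
  have mul': "freq {..<n} (\<lambda>a. \<sigma> (g \<otimes>\<^bsub>L\<^esub> h) a \<noteq> \<sigma> g (\<sigma> h a)) \<le> \<epsilon> / 2"
    if "g \<in> F'" "h \<in> F'" for g h
    using mul that unfolding hamming_eq_freq by force
  have FF': "g \<in> F'" if "g \<in> F" for g using that by (simp add: F'_def)
  show ?thesis
  proof
    show "bij_betw (\<sigma> g) {..<n} {..<n}" if "g \<in> carrier L" for g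
      using perm that by (simp add: permutes_imp_bij)
    show "freq {..<n} (\<lambda>a. \<sigma> (g \<otimes>\<^bsub>L\<^esub> h) a \<noteq> \<sigma> g (\<sigma> h a)) \<le> \<epsilon>" if "g \<in> F" "h \<in> F" for g h
      using mul'[OF that[THEN FF']] F' by simp
    show "freq {..<n} (\<lambda>a. \<sigma> g a = a) \<le> \<epsilon>" if "g \<in> F" "g \<noteq> \<one>\<^bsub>L\<^esub>" for g
      using free'[OF FF'[OF that(1)] that(2)] F' by simp
    show "freq {..<n} (\<lambda>a. \<sigma> g a = \<sigma> h a) \<le> \<epsilon>" if gh: "g \<in> F" "h \<in> F" "g \<noteq> h" for g h
    proof -
      let ?k = "inv\<^bsub>L\<^esub> h \<otimes>\<^bsub>L\<^esub> g"
      have c: "g \<in> carrier L" "h \<in> carrier L" using gh assms(3) by auto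
      have k: "?k \<in> F'" using gh unfolding F'_def by force
      have hk: "h \<otimes>\<^bsub>L\<^esub> ?k = g" using c by (simp add: m_assoc[symmetric])
      have k1: "?k \<noteq> \<one>\<^bsub>L\<^esub>" using hk c gh(3) by auto
      have "inj (\<sigma> h)" using perm c permutes_inj by blast
      then have "freq {..<n} (\<lambda>a. \<sigma> g a = \<sigma> h a)
          \<le> freq {..<n} (\<lambda>a. \<sigma> (h \<otimes>\<^bsub>L\<^esub> ?k) a \<noteq> \<sigma> h (\<sigma> ?k a) \<or> \<sigma> ?k a = a)"
        unfolding hk by (intro freq_mono) (auto simp: inj_eq)
      also have "\<dots> \<le> freq {..<n} (\<lambda>a. \<sigma> (h \<otimes>\<^bsub>L\<^esub> ?k) a \<noteq> \<sigma> h (\<sigma> ?k a))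
          + freq {..<n} (\<lambda>a. \<sigma> ?k a = a)"
        by (intro freq_disj) simp
      also have "\<dots> \<le> \<epsilon>" using mul'[OF FF'[OF gh(2)] k] free'[OF k k1] by simp
      finally show ?thesis .
    qed
  qed fact
qed

section \<open>Random partitions along an amenable subgroup\<close>

text \<open>A permutation is read as an ordering of \<open>V\<close> by its values. Composition with
  the transposition of \<open>c\<close> and \<open>d\<close> turns orderings with minimum of
  \<open>S\<close> at \<open>c\<close> into ones with minimum at \<open>d\<close>. So all points of
  \<open>S\<close> are equally likely to be the minimum, and these events partition the
  orderings.\<close>

lemma card_permutations_minimal_at:
  fixes V :: "nat set"
  assumes "finite V" "S \<subseteq> V" "c \<in> S"
  shows "card S * card {\<omega>. \<omega> permutes V \<and> (\<forall>d\<in>S. \<omega> c \<le> \<omega> d)} = card {\<omega>. \<omega> permutes V}"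
proof -
  define N where "N c = {\<omega>. \<omega> permutes V \<and> (\<forall>d\<in>S. \<omega> c \<le> \<omega> d)}" for c
  have S: "finite S" using assms finite_subset by blast
  have fin: "finite {\<omega>. \<omega> permutes V}" by (rule finite_permutations[OF assms(1)])
  then have finN: "finite (N c)" for c unfolding N_def by (rule rev_finite_subset) auto
  have le: "card (N c) \<le> card (N d)" if cd: "c \<in> S" "d \<in> S" for c d
  proof (rule card_inj_on_le[where f = "\<lambda>\<omega>. \<omega> \<circ> transpose c d"])
    show "inj_on (\<lambda>\<omega>. \<omega> \<circ> transpose c d) (N c)"
    proof (rule inj_onI, rule ext)
      fix \<omega> \<omega>' :: "nat \<Rightarrow> nat" and x
      assume "\<omega> \<circ> transpose c d = \<omega>' \<circ> transpose c d"
      from fun_cong[OF this, of "transpose c d x"] show "\<omega> x = \<omega>' x" by simp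
    qed
    have "\<omega> \<circ> transpose c d \<in> N d" if "\<omega> \<in> N c" for \<omega>
    proof -
      have "\<omega> \<circ> transpose c d permutes V"
        using that cd assms(2) unfolding N_def
        by (intro permutes_compose permutes_swap_id) auto
      moreover have "transpose c d x \<in> S" if "x \<in> S" for x
        using that cd by (auto simp: transpose_def)
      ultimately show ?thesis using that unfolding N_def by auto
    qed
    then show "(\<lambda>\<omega>. \<omega> \<circ> transpose c d) ` N c \<subseteq> N d" by blast
  qed (rule finN)
  have "{\<omega>. \<omega> permutes V} = (\<Union>d\<in>S. N d)"
  proof -
    have "\<exists>d\<in>S. \<omega> \<in> N d" if "\<omega> permutes V" for \<omega>
    proof -
      have "Min (\<omega> ` S) \<in> \<omega> ` S" using S assms(3) by (intro Min_in) auto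
      then obtain d where "d \<in> S" "\<omega> d = Min (\<omega> ` S)" by auto
      then have "\<forall>x\<in>S. \<omega> d \<le> \<omega> x" using S by simp
      then show ?thesis using that \<open>d \<in> S\<close> unfolding N_def by blast
    qed
    then show ?thesis unfolding N_def by blast
  qed
  moreover have "N d \<inter> N d' = {}" if dd: "d \<in> S" "d' \<in> S" "d \<noteq> d'" for d d'
  proof (rule ccontr)
    assume "N d \<inter> N d' \<noteq> {}"
    then obtain \<omega> where "\<omega> permutes V" "\<omega> d \<le> \<omega> d'" "\<omega> d' \<le> \<omega> d"
      using dd(1,2) unfolding N_def by blast
    then show False using dd(3) permutes_inj[of \<omega> V] inj_eq[of \<omega> d d'] by simp
  qed
  ultimately have "card {\<omega>. \<omega> permutes V} = (\<Sum>d\<in>S. card (N d))"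
    using S finN by (simp add: card_UN_disjoint)
  also have "\<dots> = (\<Sum>d\<in>S. card (N c))"
    using le assms(3) by (intro sum.cong) (auto intro: le_antisym)
  finally show ?thesis unfolding N_def by simp
qed

text \<open>The minimum of a uniformly random ordering over \<open>S\<^sub>1 \<union> S\<^sub>2\<close> is attained at a uniformly
  distributed point, and the two minima agree as soon as this point lies in \<open>S\<^sub>1 \<inter> S\<^sub>2\<close>.\<close>

lemma freq_Min_permutation_neq:
  fixes V :: "nat set"
  assumes V: "finite V" and S: "S1 \<subseteq> V" "S2 \<subseteq> V" "S1 \<noteq> {}" "S2 \<noteq> {}"
  shows "freq {\<omega>. \<omega> permutes V} (\<lambda>\<omega>. Min (\<omega> ` S1) \<noteq> Min (\<omega> ` S2))
    \<le> real (card ((S1 - S2) \<union> (S2 - S1))) / real (card (S1 \<union> S2))"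
proof -
  let ?\<Omega> = "{\<omega>. \<omega> permutes V}"
  define S D where "S = S1 \<union> S2" and "D = (S1 - S2) \<union> (S2 - S1)"
  define N where "N c = {\<omega>. \<omega> permutes V \<and> (\<forall>d\<in>S. \<omega> c \<le> \<omega> d)}" for c
  have fin: "finite S1" "finite S2" "finite S" "finite D"
    using finite_subset[OF S(1) V] finite_subset[OF S(2) V] unfolding S_def D_def by auto
  have \<Omega>: "finite ?\<Omega>" "card ?\<Omega> > 0"
    using V card_permutations[OF HOL.refl V] by (auto simp: finite_permutations)
  have cS: "card S > 0" using S fin unfolding S_def by (simp add: card_gt_0_iff)
  have sub: "{\<omega> \<in> ?\<Omega>. Min (\<omega> ` S1) \<noteq> Min (\<omega> ` S2)} \<subseteq> (\<Union>c\<in>D. N c)"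
  proof
    fix \<omega> assume \<omega>: "\<omega> \<in> {\<omega> \<in> ?\<Omega>. Min (\<omega> ` S1) \<noteq> Min (\<omega> ` S2)}"
    have "Min (\<omega> ` S) \<in> \<omega> ` S" using S fin unfolding S_def by (intro Min_in) auto
    then obtain c where c: "c \<in> S" "\<omega> c = Min (\<omega> ` S)" by auto
    then have min: "\<omega> c \<le> \<omega> d" if "d \<in> S" for d using that fin by auto
    have "Min (\<omega> ` S1) = \<omega> c" if "c \<in> S1"
      using that fin min unfolding S_def by (intro Min_eqI) auto
    moreover have "Min (\<omega> ` S2) = \<omega> c" if "c \<in> S2"
      using that fin min unfolding S_def by (intro Min_eqI) auto
    ultimately have "c \<in> D" using \<omega> c(1) unfolding S_def D_def by auto
    then show "\<omega> \<in> (\<Union>c\<in>D. N c)" using \<omega> min unfolding N_def by auto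
  qed
  have N: "real (card (N c)) = real (card ?\<Omega>) / real (card S)" if "c \<in> D" for c
  proof -
    have "card S * card (N c) = card ?\<Omega>" unfolding N_def
      using that assms by (intro card_permutations_minimal_at) (auto simp: S_def D_def)
    then have "real (card S) * real (card (N c)) = real (card ?\<Omega>)" by (metis of_nat_mult)
    then show ?thesis using cS by (simp add: field_simps)
  qed
  have "finite (\<Union>c\<in>D. N c)"
    by (rule finite_subset[OF _ \<Omega>(1)]) (auto simp: N_def)
  then have "card {\<omega> \<in> ?\<Omega>. Min (\<omega> ` S1) \<noteq> Min (\<omega> ` S2)} \<le> card (\<Union>c\<in>D. N c)"
    using sub by (intro card_mono)
  also have "\<dots> \<le> (\<Sum>c\<in>D. card (N c))" by (rule card_UN_le[OF fin(4)])
  finally have "real (card {\<omega> \<in> ?\<Omega>. Min (\<omega> ` S1) \<noteq> Min (\<omega> ` S2)}) \<le> real (\<Sum>c\<in>D. card (N c))"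
    by (rule of_nat_mono)
  also have "\<dots> = (\<Sum>c\<in>D. real (card (N c)))" by simp
  also have "\<dots> = real (card D) * (real (card ?\<Omega>) / real (card S))" using N by simp
  finally show ?thesis
    using \<Omega>(2) cS unfolding freq_def S_def[symmetric] D_def[symmetric] by (simp add: field_simps)
qed

text \<open>A point of \<open>A\<close> is a point of a sofic approximation together with an
  ordering, which the group leaves fixed; counting in \<open>A\<close> thus averages over random
  partitions. The tile is the rank of the smallest point in a translate of the Folner set.\<close>

lemma sofic_amenable_partition:
  fixes L :: "'b monoid"
  assumes L: "sofic L" and H: "subgroup H L" and am: "amenable (L\<lparr>carrier := H\<rparr>)"
    and E: "finite E" "E \<subseteq> carrier L" and \<epsilon>: "(\<epsilon>::real) > 0"
  obtains A :: "(nat \<times> (nat \<Rightarrow> nat)) set" and \<sigma> and tile :: "nat \<times> (nat \<Rightarrow> nat) \<Rightarrow> nat"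
  where "finite A" "A \<noteq> {}" "\<And>g. g \<in> carrier L \<Longrightarrow> bij_betw (\<sigma> g) A A"
    "\<And>g h. g \<in> E \<Longrightarrow> h \<in> E \<Longrightarrow> freq A (\<lambda>a. \<sigma> (g \<otimes>\<^bsub>L\<^esub> h) a \<noteq> \<sigma> g (\<sigma> h a)) \<le> \<epsilon>"
    "\<And>g. g \<in> E \<Longrightarrow> g \<noteq> \<one>\<^bsub>L\<^esub> \<Longrightarrow> freq A (\<lambda>a. \<sigma> g a = a) \<le> \<epsilon>"
    "\<And>h. h \<in> E \<Longrightarrow> h \<in> H \<Longrightarrow> freq A (\<lambda>a. tile (\<sigma> h a) \<noteq> tile a) \<le> \<epsilon>"
    "\<And>g. g \<in> E \<Longrightarrow> g \<notin> H \<Longrightarrow> freq A (\<lambda>a. tile (\<sigma> g a) = tile a) \<le> \<epsilon>"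
proof -
  interpret group L using L by (simp add: sofic_def)
  interpret H: subgroup H L by fact
  \<comment> \<open>Inverses enter because the points of the tile set of \<open>\<sigma> h a\<close>
    are given by the products of the inverse of \<open>t\<close> with \<open>h\<close>, which are
    the inverses of the elements of the inverse of \<open>h\<close> times \<open>T\<close>.\<close>
  have invH: "finite (m_inv L ` (E \<inter> H)) \<and> m_inv L ` (E \<inter> H) \<subseteq> carrier (L\<lparr>carrier := H\<rparr>) \<and> \<epsilon> / 2 > 0"
    using E \<epsilon> by auto
  obtain T where T: "finite T" "T \<noteq> {}" "T \<subseteq> H"
    and fol: "\<And>h. h \<in> E \<inter> H \<Longrightarrow> real (card (((inv\<^bsub>L\<^esub> h <#\<^bsub>L\<^esub> T) - T) \<union> (T - (inv\<^bsub>L\<^esub> h <#\<^bsub>L\<^esub> T))))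
        < \<epsilon> / 2 * real (card T)"
    using am[unfolded amenable_def, THEN conjunct2, THEN spec, THEN spec, THEN mp, OF invH]
    unfolding l_coset_def by auto
  have TL: "t \<in> carrier L" if "t \<in> T" for t using T that by auto
  \<comment> \<open>All elements whose action occurs when the candidate sets of \<open>a\<close> and
    \<open>\<sigma> g a\<close> are compared, for \<open>g\<close> in \<open>E\<close>.\<close>
  define V where "V = m_inv L ` T \<union> (\<lambda>(t, g). inv\<^bsub>L\<^esub> t \<otimes>\<^bsub>L\<^esub> g) ` (T \<times> E)"
  define F where "F = E \<union> V"
  have F: "finite F" "F \<subseteq> carrier L" using E T TL unfolding F_def V_def by auto
  have V1: "inv\<^bsub>L\<^esub> t \<in> V" and V2: "g \<in> E \<Longrightarrow> inv\<^bsub>L\<^esub> t \<otimes>\<^bsub>L\<^esub> g \<in> V" if "t \<in> T" for t g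
    using that unfolding V_def by auto
  define m where "m = card (F \<times> F)"
  \<comment> \<open>Each of the \<open>m\<close> pairs from \<open>F\<close> contributes two events
    of proportion at most \<open>\<delta>\<close>, so the bad points below have proportion at most
    \<open>\<epsilon> / 2\<close>. The other half is kept for the Folner error.\<close>
  define \<delta> where "\<delta> = \<epsilon> / (4 * (real m + 1))"
  have \<delta>: "\<delta> > 0" "\<delta> \<le> \<epsilon>" "real m * (2 * \<delta>) \<le> \<epsilon> / 2"
    using \<epsilon> unfolding \<delta>_def by (simp_all add: field_simps)
  obtain n \<sigma> where n: "n > 0" and bij: "\<And>g. g \<in> carrier L \<Longrightarrow> bij_betw (\<sigma> g) {..<n::nat} {..<n}"
    and mul: "\<And>g h. g \<in> F \<Longrightarrow> h \<in> F \<Longrightarrow> freq {..<n} (\<lambda>a. \<sigma> (g \<otimes>\<^bsub>L\<^esub> h) a \<noteq> \<sigma> g (\<sigma> h a)) \<le> \<delta>"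
    and sep: "\<And>g h. g \<in> F \<Longrightarrow> h \<in> F \<Longrightarrow> g \<noteq> h \<Longrightarrow> freq {..<n} (\<lambda>a. \<sigma> g a = \<sigma> h a) \<le> \<delta>"
    and free: "\<And>g. g \<in> F \<Longrightarrow> g \<noteq> \<one>\<^bsub>L\<^esub> \<Longrightarrow> freq {..<n} (\<lambda>a. \<sigma> g a = a) \<le> \<delta>"
    by (rule sofic_separating[OF L F \<delta>(1)]) blast
  have \<sigma>n: "\<sigma> g a < n" if "g \<in> carrier L" "a < n" for g a
    using bij[OF that(1)] that(2) by (auto simp: bij_betw_def)
  \<comment> \<open>Off this set the action of \<open>F\<close> at \<open>a\<close> is an exact copy
    of the group: products are respected and distinct elements send \<open>a\<close> to distinct
    points.\<close>
  define bad where "bad a \<longleftrightarrow> (\<exists>p\<in>F \<times> F. \<sigma> (fst p \<otimes>\<^bsub>L\<^esub> snd p) a \<noteq> \<sigma> (fst p) (\<sigma> (snd p) a)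
      \<or> (fst p \<noteq> snd p \<and> \<sigma> (fst p) a = \<sigma> (snd p) a))" for a
  have bad: "freq {..<n} bad \<le> \<epsilon> / 2"
  proof -
    have "freq {..<n} (\<lambda>a. \<sigma> (g \<otimes>\<^bsub>L\<^esub> h) a \<noteq> \<sigma> g (\<sigma> h a) \<or> (g \<noteq> h \<and> \<sigma> g a = \<sigma> h a)) \<le> 2 * \<delta>"
      if "g \<in> F" "h \<in> F" for g h
    proof -
      have "freq {..<n} (\<lambda>a. g \<noteq> h \<and> \<sigma> g a = \<sigma> h a) \<le> \<delta>"
        using sep[OF that] \<delta>(1) by (cases "g = h") (simp_all add: freq_False)
      then show ?thesis
        using mul[OF that] freq_disj[of "{..<n}" "\<lambda>a. \<sigma> (g \<otimes>\<^bsub>L\<^esub> h) a \<noteq> \<sigma> g (\<sigma> h a)"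
            "\<lambda>a. g \<noteq> h \<and> \<sigma> g a = \<sigma> h a"] by simp
    qed
    then have "freq {..<n} bad \<le> real (card (F \<times> F)) * (2 * \<delta>)"
      unfolding bad_def using F(1) by (intro freq_bex) auto
    then show ?thesis using \<delta>(3) unfolding m_def by simp
  qed
  have good_mul: "\<sigma> (g \<otimes>\<^bsub>L\<^esub> h) a = \<sigma> g (\<sigma> h a)" if "\<not> bad a" "g \<in> F" "h \<in> F" for a g h
    using that unfolding bad_def by auto
  have good_sep: "g = h" if "\<not> bad a" "g \<in> F" "h \<in> F" "\<sigma> g a = \<sigma> h a" for a g h
    using that unfolding bad_def by auto
  define \<Omega> where "\<Omega> = {\<omega>. \<omega> permutes {..<n}}"
  have \<Omega>: "finite \<Omega>" "\<Omega> \<noteq> {}"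
    unfolding \<Omega>_def by (auto intro: finite_permutations exI[of _ id] simp: permutes_id)
  define A where "A = {..<n} \<times> \<Omega>"
  define \<tau> where "\<tau> g = map_prod (\<sigma> g) (id :: (nat \<Rightarrow> nat) \<Rightarrow> _)" for g
  define C where "C a = (\<lambda>t. \<sigma> (inv\<^bsub>L\<^esub> t) a) ` T" for a
  define tile :: "nat \<times> (nat \<Rightarrow> nat) \<Rightarrow> nat" where "tile p = Min (snd p ` C (fst p))" for p
  have C: "finite (C a)" "C a \<noteq> {}" for a using T unfolding C_def by auto
  have Cn: "C a \<subseteq> {..<n}" if "a < n" for a
    using that TL \<sigma>n unfolding C_def by auto
  have lift: "freq A (\<lambda>p. P (fst p)) = freq {..<n} P" for P
    unfolding A_def by (rule freq_Times_fst[OF \<Omega>])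
  have finA: "finite A" using \<Omega> unfolding A_def by simp
  show ?thesis
  proof
    show "finite A" by (fact finA)
    show "A \<noteq> {}" using \<Omega> n unfolding A_def by auto
    show "bij_betw (\<tau> g) A A" if "g \<in> carrier L" for g
      unfolding \<tau>_def A_def by (intro bij_betw_map_prod bij that) simp
    show "freq A (\<lambda>a. \<tau> (g \<otimes>\<^bsub>L\<^esub> h) a \<noteq> \<tau> g (\<tau> h a)) \<le> \<epsilon>" if "g \<in> E" "h \<in> E" for g h
    proof -
      have "freq A (\<lambda>a. \<tau> (g \<otimes>\<^bsub>L\<^esub> h) a \<noteq> \<tau> g (\<tau> h a))
          = freq {..<n} (\<lambda>a. \<sigma> (g \<otimes>\<^bsub>L\<^esub> h) a \<noteq> \<sigma> g (\<sigma> h a))"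
        unfolding lift[symmetric] by (intro freq_cong) (auto simp: \<tau>_def)
      then show ?thesis using mul[of g h] that \<delta>(2) unfolding F_def by simp
    qed
    show "freq A (\<lambda>a. \<tau> g a = a) \<le> \<epsilon>" if "g \<in> E" "g \<noteq> \<one>\<^bsub>L\<^esub>" for g
    proof -
      have "freq A (\<lambda>a. \<tau> g a = a) = freq {..<n} (\<lambda>a. \<sigma> g a = a)"
        unfolding lift[symmetric] by (intro freq_cong) (auto simp: \<tau>_def)
      then show ?thesis using free[of g] that \<delta>(2) unfolding F_def by simp
    qed
    show "freq A (\<lambda>a. tile (\<tau> h a) \<noteq> tile a) \<le> \<epsilon>" if h: "h \<in> E" "h \<in> H" for h
    proof -
      have hL: "h \<in> carrier L" using h by auto
      \<comment> \<open>Bad points are excluded inside \<open>P\<close>, so that the average over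
        orderings is small for every \<open>a\<close>, as \<open>freq_Times_le\<close>
        requires.\<close>
      define P where "P a \<omega> \<longleftrightarrow> \<not> bad a \<and> Min (\<omega> ` C (\<sigma> h a)) \<noteq> Min (\<omega> ` C a)"
        for a and \<omega> :: "nat \<Rightarrow> nat"
      have P: "freq \<Omega> (P a) \<le> \<epsilon> / 2" if a: "a \<in> {..<n}" for a
      proof (cases "bad a")
        case True
        then show ?thesis using \<epsilon> by (simp add: P_def freq_False)
      next
        case False
        let ?u = "\<lambda>t. \<sigma> (inv\<^bsub>L\<^esub> t) a" and ?T = "inv\<^bsub>L\<^esub> h <#\<^bsub>L\<^esub> T"
        have inv_h: "inv\<^bsub>L\<^esub> (inv\<^bsub>L\<^esub> h \<otimes>\<^bsub>L\<^esub> t) = inv\<^bsub>L\<^esub> t \<otimes>\<^bsub>L\<^esub> h" if "t \<in> T" for t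
          using TL[OF that] hL by (simp add: inv_mult_group)
        have inV: "inv\<^bsub>L\<^esub> t \<in> F" "t \<in> carrier L" if "t \<in> T \<union> ?T" for t
          using that V1 V2[OF _ h(1)] TL hL inv_h unfolding F_def l_coset_def by auto
        have inj: "inj_on ?u (T \<union> ?T)"
        proof (rule inj_onI)
          fix s t assume st: "s \<in> T \<union> ?T" "t \<in> T \<union> ?T" "?u s = ?u t"
          then have "inv\<^bsub>L\<^esub> s = inv\<^bsub>L\<^esub> t" using good_sep[OF False] inV by blast
          then show "s = t" using inV st by (metis inv_inv)
        qed
        have Ch: "C (\<sigma> h a) = ?u ` ?T"
        proof -
          have "\<sigma> (inv\<^bsub>L\<^esub> t) (\<sigma> h a) = ?u (inv\<^bsub>L\<^esub> h \<otimes>\<^bsub>L\<^esub> t)" if "t \<in> T" for t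
            using good_mul[OF False, of "inv\<^bsub>L\<^esub> t" h] V1[OF that] h(1) inv_h[OF that]
            unfolding F_def by auto
          then show ?thesis unfolding C_def l_coset_def by (auto simp: image_iff)
        qed
        have Ca: "C a = ?u ` T" unfolding C_def ..
        have finT: "finite ?T" using T unfolding l_coset_def by auto
        \<comment> \<open>At a good point \<open>?u\<close> is injective on
          \<open>T \<union> ?T\<close>. It therefore carries the symmetric difference of the two
          translates over without loss, and the Folner estimate applies to the candidate
          sets.\<close>
        have diff: "(C (\<sigma> h a) - C a) \<union> (C a - C (\<sigma> h a)) = ?u ` ((?T - T) \<union> (T - ?T))"
          unfolding Ch Ca image_Un
          using inj_on_image_set_diff[OF inj, of ?T T] inj_on_image_set_diff[OF inj, of T ?T] by auto
        have "card ((C (\<sigma> h a) - C a) \<union> (C a - C (\<sigma> h a))) = card ((?T - T) \<union> (T - ?T))"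
          unfolding diff by (rule card_image) (rule inj_on_subset[OF inj], auto)
        then have num: "real (card ((C (\<sigma> h a) - C a) \<union> (C a - C (\<sigma> h a)))) \<le> \<epsilon> / 2 * real (card T)"
          using fol[of h] h by simp
        have "card T = card (C a)" unfolding Ca by (rule card_image[symmetric]) (rule inj_on_subset[OF inj], auto)
        also have "\<dots> \<le> card (C (\<sigma> h a) \<union> C a)" using C by (intro card_mono) auto
        finally have den: "card T \<le> card (C (\<sigma> h a) \<union> C a)" .
        have T0: "card T > 0" using T by (simp add: card_gt_0_iff)
        have "freq \<Omega> (P a) = freq \<Omega> (\<lambda>\<omega>. Min (\<omega> ` C (\<sigma> h a)) \<noteq> Min (\<omega> ` C a))"
          using False by (intro freq_cong) (simp add: P_def)
        also have "\<dots> \<le> real (card ((C (\<sigma> h a) - C a) \<union> (C a - C (\<sigma> h a)))) / real (card (C (\<sigma> h a) \<union> C a))"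
          unfolding \<Omega>_def using a C Cn \<sigma>n[OF hL] by (intro freq_Min_permutation_neq) auto
        also have "\<dots> \<le> (\<epsilon> / 2 * real (card T)) / real (card T)"
          using num den T0 by (intro frac_le) auto
        also have "\<dots> = \<epsilon> / 2" using T0 by simp
        finally show ?thesis .
      qed
      have "freq A (\<lambda>p. tile (\<tau> h p) \<noteq> tile p) \<le> freq A (\<lambda>p. bad (fst p) \<or> P (fst p) (snd p))"
        by (intro freq_mono finA) (auto simp: P_def tile_def \<tau>_def)
      also have "\<dots> \<le> freq A (\<lambda>p. bad (fst p)) + freq A (\<lambda>p. P (fst p) (snd p))"
        by (rule freq_disj[OF finA])
      also have "\<dots> \<le> \<epsilon> / 2 + \<epsilon> / 2"
        using bad freq_Times_le[OF _ \<Omega>(1), of "{..<n}" "\<epsilon> / 2" P] P \<epsilon> unfolding lift A_def[symmetric]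
        by (intro add_mono) auto
      finally show ?thesis by simp
    qed
    show "freq A (\<lambda>a. tile (\<tau> g a) = tile a) \<le> \<epsilon>" if g: "g \<in> E" "g \<notin> H" for g
    proof -
      have gL: "g \<in> carrier L" using g E by auto
      \<comment> \<open>Equal ranks mean a common point of the two candidate sets, since
        \<open>\<omega>\<close> is injective. At a good point this gives an equation in the group
        that writes \<open>g\<close> as \<open>s\<close> times the inverse of \<open>t\<close>, an
        element of \<open>H\<close>. This holds for every ordering, so no averaging occurs
        here.\<close>
      have "bad (fst p)" if p: "p \<in> A" "tile (\<tau> g p) = tile p" for p
      proof (rule ccontr)
        assume good: "\<not> bad (fst p)"
        obtain a \<omega> where p_eq: "p = (a, \<omega>)" by fastforce
        have \<omega>: "inj \<omega>" using p(1) unfolding p_eq A_def \<Omega>_def by (auto intro: permutes_inj)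
        have "Min (\<omega> ` C (\<sigma> g a)) \<in> \<omega> ` C (\<sigma> g a)" "Min (\<omega> ` C a) \<in> \<omega> ` C a"
          using C by (auto intro!: Min_in)
        then obtain c d where "c \<in> C (\<sigma> g a)" "d \<in> C a" "\<omega> c = \<omega> d"
          using p(2) unfolding p_eq tile_def \<tau>_def by auto
        then obtain s t where st: "s \<in> T" "t \<in> T" and eq: "\<sigma> (inv\<^bsub>L\<^esub> s) (\<sigma> g a) = \<sigma> (inv\<^bsub>L\<^esub> t) a"
          using \<omega> unfolding C_def inj_eq[OF \<omega>] by auto
        have "\<sigma> (inv\<^bsub>L\<^esub> s \<otimes>\<^bsub>L\<^esub> g) a = \<sigma> (inv\<^bsub>L\<^esub> t) a"
          using good_mul[of a "inv\<^bsub>L\<^esub> s" g] good g V1[OF st(1)] eq unfolding p_eq F_def by simp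
        then have *: "inv\<^bsub>L\<^esub> s \<otimes>\<^bsub>L\<^esub> g = inv\<^bsub>L\<^esub> t"
          using good_sep[of a "inv\<^bsub>L\<^esub> s \<otimes>\<^bsub>L\<^esub> g" "inv\<^bsub>L\<^esub> t"] good V1[OF st(2)] V2[OF st(1) g(1)]
          unfolding p_eq F_def by simp
        have "g = s \<otimes>\<^bsub>L\<^esub> inv\<^bsub>L\<^esub> t"
          unfolding *[symmetric] using TL[OF st(1)] gL by (simp add: m_assoc[symmetric])
        moreover have "s \<otimes>\<^bsub>L\<^esub> inv\<^bsub>L\<^esub> t \<in> H" using st T(3) by auto
        ultimately show False using g(2) by simp
      qed
      then have "freq A (\<lambda>a. tile (\<tau> g a) = tile a) \<le> freq A (\<lambda>p. bad (fst p))"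
        by (intro freq_mono finA)
      then show ?thesis using bad \<epsilon> unfolding lift by simp
    qed
  qed
qed

text \<open>The tile ignores the coordinate from \<open>K\<close>, so membership in
  \<open>H \<times> carrier K\<close> is decided by the first factor. A nontrivial pair is
  nontrivial in some coordinate, and a fixed point of the product action is fixed in both.\<close>

lemma sofic_amenable_partition_times:
  fixes L :: "'b monoid" and K :: "'c monoid"
  assumes L: "sofic L" and H: "subgroup H L" and am: "amenable (L\<lparr>carrier := H\<rparr>)" and K: "sofic K"
    and E: "finite E" "E \<subseteq> carrier (L \<times>\<times> K)" and \<epsilon>: "(\<epsilon>::real) > 0"
  obtains A :: "((nat \<times> (nat \<Rightarrow> nat)) \<times> nat) set" and \<sigma> and tile :: "_ \<Rightarrow> nat"
  where "finite A" "A \<noteq> {}" "\<And>g. g \<in> carrier (L \<times>\<times> K) \<Longrightarrow> bij_betw (\<sigma> g) A A"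
    "\<And>g h. g \<in> E \<Longrightarrow> h \<in> E \<Longrightarrow> freq A (\<lambda>a. \<sigma> (g \<otimes>\<^bsub>L \<times>\<times> K\<^esub> h) a \<noteq> \<sigma> g (\<sigma> h a)) \<le> \<epsilon>"
    "\<And>g. g \<in> E \<Longrightarrow> g \<noteq> \<one>\<^bsub>L \<times>\<times> K\<^esub> \<Longrightarrow> freq A (\<lambda>a. \<sigma> g a = a) \<le> \<epsilon>"
    "\<And>h. h \<in> E \<Longrightarrow> h \<in> H \<times> carrier K \<Longrightarrow> freq A (\<lambda>a. tile (\<sigma> h a) \<noteq> tile a) \<le> \<epsilon>"
    "\<And>g. g \<in> E \<Longrightarrow> g \<notin> H \<times> carrier K \<Longrightarrow> freq A (\<lambda>a. tile (\<sigma> g a) = tile a) \<le> \<epsilon>"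
proof -
  have E1: "finite (fst ` E)" "fst ` E \<subseteq> carrier L" and E2: "finite (snd ` E)" "snd ` E \<subseteq> carrier K"
    using E by auto
  have \<epsilon>2: "\<epsilon> / 2 > 0" using \<epsilon> by simp
  obtain A :: "(nat \<times> (nat \<Rightarrow> nat)) set" and \<sigma> and tile :: "nat \<times> (nat \<Rightarrow> nat) \<Rightarrow> nat"
  where A: "finite A" "A \<noteq> {}" "\<And>g. g \<in> carrier L \<Longrightarrow> bij_betw (\<sigma> g) A A"
    "\<And>g h. g \<in> fst ` E \<Longrightarrow> h \<in> fst ` E \<Longrightarrow> freq A (\<lambda>a. \<sigma> (g \<otimes>\<^bsub>L\<^esub> h) a \<noteq> \<sigma> g (\<sigma> h a)) \<le> \<epsilon> / 2"
    "\<And>g. g \<in> fst ` E \<Longrightarrow> g \<noteq> \<one>\<^bsub>L\<^esub> \<Longrightarrow> freq A (\<lambda>a. \<sigma> g a = a) \<le> \<epsilon> / 2"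
    "\<And>h. h \<in> fst ` E \<Longrightarrow> h \<in> H \<Longrightarrow> freq A (\<lambda>a. tile (\<sigma> h a) \<noteq> tile a) \<le> \<epsilon> / 2"
    "\<And>g. g \<in> fst ` E \<Longrightarrow> g \<notin> H \<Longrightarrow> freq A (\<lambda>a. tile (\<sigma> g a) = tile a) \<le> \<epsilon> / 2"
    by (rule sofic_amenable_partition[OF L H am E1 \<epsilon>2]) blast
  obtain n \<kappa> where n: "n > 0" and bij: "\<And>g. g \<in> carrier K \<Longrightarrow> bij_betw (\<kappa> g) {..<n::nat} {..<n}"
    and mul: "\<And>g h. g \<in> snd ` E \<Longrightarrow> h \<in> snd ` E \<Longrightarrow>
        freq {..<n} (\<lambda>a. \<kappa> (g \<otimes>\<^bsub>K\<^esub> h) a \<noteq> \<kappa> g (\<kappa> h a)) \<le> \<epsilon> / 2"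
    and "\<And>g h. g \<in> snd ` E \<Longrightarrow> h \<in> snd ` E \<Longrightarrow> g \<noteq> h \<Longrightarrow>
        freq {..<n} (\<lambda>a. \<kappa> g a = \<kappa> h a) \<le> \<epsilon> / 2"
    and free: "\<And>g. g \<in> snd ` E \<Longrightarrow> g \<noteq> \<one>\<^bsub>K\<^esub> \<Longrightarrow> freq {..<n} (\<lambda>a. \<kappa> g a = a) \<le> \<epsilon> / 2"
    by (rule sofic_separating[OF K E2 \<epsilon>2]) blast
  define B where "B = A \<times> {..<n}"
  define \<tau> where "\<tau> g = map_prod (\<sigma> (fst g)) (\<kappa> (snd g))" for g
  have B: "finite B" "B \<noteq> {}" using A n unfolding B_def by auto
  have lift1: "freq B (\<lambda>p. P (fst p)) = freq A P" for P
    unfolding B_def using n by (intro freq_Times_fst) auto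
  have lift2: "freq B (\<lambda>p. P (snd p)) = freq {..<n} P" for P
    unfolding B_def using A by (intro freq_Times_snd) auto
  show ?thesis
  proof
    show "finite B" "B \<noteq> {}" by fact+
    show "bij_betw (\<tau> g) B B" if "g \<in> carrier (L \<times>\<times> K)" for g
      unfolding \<tau>_def B_def using that by (intro bij_betw_map_prod A(3) bij) auto
    show "freq B (\<lambda>a. \<tau> (g \<otimes>\<^bsub>L \<times>\<times> K\<^esub> h) a \<noteq> \<tau> g (\<tau> h a)) \<le> \<epsilon>" if "g \<in> E" "h \<in> E" for g h
    proof -
      have "freq B (\<lambda>a. \<tau> (g \<otimes>\<^bsub>L \<times>\<times> K\<^esub> h) a \<noteq> \<tau> g (\<tau> h a))
          \<le> freq B (\<lambda>p. \<sigma> (fst g \<otimes>\<^bsub>L\<^esub> fst h) (fst p) \<noteq> \<sigma> (fst g) (\<sigma> (fst h) (fst p))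
            \<or> \<kappa> (snd g \<otimes>\<^bsub>K\<^esub> snd h) (snd p) \<noteq> \<kappa> (snd g) (\<kappa> (snd h) (snd p)))"
        by (intro freq_mono B) (auto simp: \<tau>_def mult_DirProd')
      also have "\<dots> \<le> freq B (\<lambda>p. \<sigma> (fst g \<otimes>\<^bsub>L\<^esub> fst h) (fst p) \<noteq> \<sigma> (fst g) (\<sigma> (fst h) (fst p)))
          + freq B (\<lambda>p. \<kappa> (snd g \<otimes>\<^bsub>K\<^esub> snd h) (snd p) \<noteq> \<kappa> (snd g) (\<kappa> (snd h) (snd p)))"
        by (rule freq_disj[OF B(1)])
      also have "\<dots> = freq A (\<lambda>a. \<sigma> (fst g \<otimes>\<^bsub>L\<^esub> fst h) a \<noteq> \<sigma> (fst g) (\<sigma> (fst h) a))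
          + freq {..<n} (\<lambda>a. \<kappa> (snd g \<otimes>\<^bsub>K\<^esub> snd h) a \<noteq> \<kappa> (snd g) (\<kappa> (snd h) a))"
        by (simp only: lift1[of "\<lambda>a. \<sigma> (fst g \<otimes>\<^bsub>L\<^esub> fst h) a \<noteq> \<sigma> (fst g) (\<sigma> (fst h) a)"]
            lift2[of "\<lambda>a. \<kappa> (snd g \<otimes>\<^bsub>K\<^esub> snd h) a \<noteq> \<kappa> (snd g) (\<kappa> (snd h) a)"])
      also have "\<dots> \<le> \<epsilon> / 2 + \<epsilon> / 2" using that by (intro add_mono A(4) mul) auto
      finally show ?thesis by simp
    qed
    show "freq B (\<lambda>a. \<tau> g a = a) \<le> \<epsilon>" if g: "g \<in> E" "g \<noteq> \<one>\<^bsub>L \<times>\<times> K\<^esub>" for g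
    proof (cases "fst g = \<one>\<^bsub>L\<^esub>")
      case False
      have "freq B (\<lambda>a. \<tau> g a = a) \<le> freq B (\<lambda>p. \<sigma> (fst g) (fst p) = fst p)"
        by (intro freq_mono B) (auto simp: \<tau>_def)
      then show ?thesis using A(5)[of "fst g"] False g \<epsilon> lift1[of "\<lambda>a. \<sigma> (fst g) a = a"] by simp
    next
      case True
      then have "snd g \<noteq> \<one>\<^bsub>K\<^esub>" using g(2) by (cases g) auto
      moreover have "freq B (\<lambda>a. \<tau> g a = a) \<le> freq B (\<lambda>p. \<kappa> (snd g) (snd p) = snd p)"
        by (intro freq_mono B) (auto simp: \<tau>_def)
      ultimately show ?thesis using free[of "snd g"] g \<epsilon> lift2[of "\<lambda>a. \<kappa> (snd g) a = a"] by simp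
    qed
    show "freq B (\<lambda>a. (tile \<circ> fst) (\<tau> h a) \<noteq> (tile \<circ> fst) a) \<le> \<epsilon>"
      if "h \<in> E" "h \<in> H \<times> carrier K" for h
      using A(6)[of "fst h"] that \<epsilon> lift1[of "\<lambda>a. tile (\<sigma> (fst h) a) \<noteq> tile a"]
      by (auto simp: \<tau>_def)
    show "freq B (\<lambda>a. (tile \<circ> fst) (\<tau> g a) = (tile \<circ> fst) a) \<le> \<epsilon>"
      if "g \<in> E" "g \<notin> H \<times> carrier K" for g
    proof -
      have "fst g \<notin> H" using that E by (cases g) auto
      then show ?thesis
        using A(7)[of "fst g"] that \<epsilon> lift1[of "\<lambda>a. tile (\<sigma> (fst g) a) = tile a"]
        by (auto simp: \<tau>_def)
    qed
  qed
qed

section \<open>Finite permutation models of free products of involutions\<close>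

text \<open>The letter \<open>y\<close> flips the edges labelled \<open>y\<close> of the path whose successive edge labels are
  the letters of \<open>w\<close>. Reading \<open>w\<close> from the right walks from the end of the path to its start.\<close>

definition path_flip :: "'y list \<Rightarrow> 'y \<Rightarrow> nat \<Rightarrow> nat" where
  "path_flip w y j =
    (if 0 < j \<and> j \<le> length w \<and> w ! (j - 1) = y then j - 1
     else if j < length w \<and> w ! j = y then j + 1 else j)"

text \<open>Adjacent letters differ, so no vertex meets two edges with the same label. The edges
  labelled \<open>y\<close> form a matching, and exchanging their ends is an involution.\<close>

lemma path_flip_involution:
  assumes "distinct_adj w"
  shows "path_flip w y (path_flip w y j) = j"
proof -
  have adj: "w ! k \<noteq> w ! Suc k" if "Suc k < length w" for k
    using assms that by (simp add: distinct_adj_conv_nth)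
  show ?thesis
  proof (cases j)
    case 0
    then show ?thesis by (auto simp: path_flip_def Suc_le_eq)
  next
    case (Suc k)
    then show ?thesis using adj[of k] adj[of "k - 1"] by (cases k) (auto simp: path_flip_def)
  qed
qed

lemma path_flip_permutes:
  assumes "distinct_adj w"
  shows "path_flip w y permutes {..length w}"
proof (rule bij_imp_permutes)
  have "path_flip w y ` {..length w} \<subseteq> {..length w}" by (auto simp: path_flip_def Suc_le_eq)
  then show "bij_betw (path_flip w y) {..length w} {..length w}"
    using path_flip_involution[OF assms] by (intro bij_betw_byWitness[where f' = "path_flip w y"]) auto
qed (auto simp: path_flip_def)

lemma foldr_path_flip: "foldr (path_flip w) w (length w) = 0"
proof -
  \<comment> \<open>Once the suffix from position \<open>j\<close> has been read, the walk that
    began at the last vertex stands at vertex \<open>j\<close>.\<close>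
  have "foldr (path_flip w) (drop j w) (length w) = j" if "j \<le> length w" for j
    using that
  proof (induction rule: inc_induct)
    case base
    then show ?case by simp
  next
    case (step j)
    then have "drop j w = w ! j # drop (Suc j) w" by (simp add: Cons_nth_drop_Suc)
    then show ?case using step by (simp add: path_flip_def)
  qed
  from this[of 0] show ?thesis by simp
qed

text \<open>There is one coordinate for each short word without repeated adjacent letters, and in it
  the letters act on a symmetric group by left composition with the flips of that word. The points
  are permutations rather than path vertices so that a word moves every point of \<open>C\<close>,
  not only those that start at the end of its path.\<close>

lemma ex_free_involutions:
  fixes Y :: "'y set"
  assumes "finite Y"
  obtains C :: "('y list \<Rightarrow> nat \<Rightarrow> nat) set" and \<rho>
  where "finite C" "C \<noteq> {}" "\<And>y c. c \<in> C \<Longrightarrow> \<rho> y c \<in> C" "\<And>y c. c \<in> C \<Longrightarrow> \<rho> y (\<rho> y c) = c"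
    "\<And>w c. set w \<subseteq> Y \<Longrightarrow> length w \<le> N \<Longrightarrow> w \<noteq> [] \<Longrightarrow> distinct_adj w \<Longrightarrow> c \<in> C \<Longrightarrow> foldr \<rho> w c \<noteq> c"
proof -
  define W where "W = {w. set w \<subseteq> Y \<and> length w \<le> N \<and> distinct_adj w}"
  define C where "C = (\<Pi>\<^sub>E w\<in>W. {f. f permutes {..length w}})"
  define \<rho> where "\<rho> y c = (\<lambda>w\<in>W. path_flip w y \<circ> c w)" for y and c :: "'y list \<Rightarrow> nat \<Rightarrow> nat"
  have adj: "distinct_adj w" if "w \<in> W" for w using that by (simp add: W_def)
  have "finite W" by (rule finite_subset[OF _ finite_lists_length_le[OF assms, of N]]) (auto simp: W_def)
  then have fin: "finite C" unfolding C_def by (intro finite_PiE finite_permutations) auto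
  have ne: "C \<noteq> {}" unfolding C_def PiE_eq_empty_iff using permutes_id by blast
  have \<rho>C: "\<rho> y c \<in> C" if c: "c \<in> C" for y c
    unfolding \<rho>_def C_def
  proof (rule restrict_PiE_iff[THEN iffD2], rule ballI)
    fix w assume "w \<in> W"
    then show "path_flip w y \<circ> c w \<in> {f. f permutes {..length w}}"
      using c path_flip_permutes[OF adj] permutes_compose unfolding C_def by blast
  qed
  have inv: "\<rho> y (\<rho> y c) = c" if c: "c \<in> C" for y c
  proof
    fix w
    show "\<rho> y (\<rho> y c) w = c w"
    proof (cases "w \<in> W")
      case True
      then show ?thesis using path_flip_involution[OF adj] by (simp add: \<rho>_def fun_eq_iff)
    next
      case False
      then show ?thesis using PiE_arb[OF c[unfolded C_def]] by (simp add: \<rho>_def)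
    qed
  qed
  have free: "foldr \<rho> v c \<noteq> c"
    if v: "set v \<subseteq> Y" "length v \<le> N" "v \<noteq> []" "distinct_adj v" and c: "c \<in> C" for v c
  proof
    assume eq: "foldr \<rho> v c = c"
    have vW: "v \<in> W" using v by (simp add: W_def)
    have fold: "foldr \<rho> u c v x = foldr (path_flip v) u (c v x)" for u x
      by (induction u) (simp_all add: \<rho>_def vW)
    have "c v permutes {..length v}" using c vW unfolding C_def by auto
    \<comment> \<open>The permutation \<open>c v\<close> takes the value \<open>length v\<close>
      somewhere. At that argument the word \<open>v\<close> changes the value to 0.\<close>
    then obtain x where "length v = c v x" using permutes_surj[of "c v"] by (metis surjD)
    then have "length v = foldr (path_flip v) v (length v)" using fold[of v x] eq by simp
    then show False using v(3) foldr_path_flip[of v] by simp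
  qed
  show ?thesis by (rule that[OF fin ne \<rho>C inv free])
qed

section \<open>The amalgamated free product and its approximate actions\<close>

lemma not_distinct_adj_decomp:
  assumes "\<not> distinct_adj xs"
  obtains ys x zs where "xs = ys @ x # x # zs"
  using assms
proof (induction xs arbitrary: thesis)
  case (Cons a xs)
  show ?case
  proof (cases "distinct_adj xs")
    case False
    then obtain ys x zs where "xs = ys @ x # x # zs" using Cons.IH by blast
    then show ?thesis using Cons.prems(1)[of "a # ys"] by simp
  next
    case True
    then obtain zs where "xs = a # zs" using Cons.prems(2) by (cases xs) auto
    then show ?thesis using Cons.prems(1)[of "[]"] by simp
  qed
qed simp

definition reduced_word :: "'a set \<Rightarrow> (nat \<times> 'a) list \<Rightarrow> bool" where
  "reduced_word H w \<longleftrightarrow> w \<noteq> [] \<and> (\<forall>(k, g) \<in> set w. g \<notin> H) \<and> distinct_adj (map fst w)"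

definition eval_word :: "(nat \<Rightarrow> 'a \<Rightarrow> 'z \<Rightarrow> 'z) \<Rightarrow> (nat \<times> 'a) list \<Rightarrow> 'z \<Rightarrow> 'z" where
  "eval_word \<theta> w = foldr (\<lambda>(k, g). \<theta> k g) w"

lemma eval_word_simps [simp]:
  "eval_word \<theta> [] x = x"
  "eval_word \<theta> ((k, g) # w) x = \<theta> k g (eval_word \<theta> w x)"
  "eval_word \<theta> (u @ v) x = eval_word \<theta> u (eval_word \<theta> v x)"
  by (simp_all add: eval_word_def)

lemma amal_word_simps [simp]:
  "amal_word G []"
  "amal_word G ((k, g) # w) \<longleftrightarrow> g \<in> carrier (G k) \<and> amal_word G w"
  "amal_word G (u @ v) \<longleftrightarrow> amal_word G u \<and> amal_word G v"
  by (auto simp: amal_word_def)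

section \<open>Words in the amalgam and their shortest representatives\<close>

locale amalgamation =
  fixes G :: "nat \<Rightarrow> 'a monoid" and H :: "'a set"
  assumes group_G: "group (G k)" and subgroup_H: "subgroup H (G k)"
begin

lemma H_carrier: "h \<in> H \<Longrightarrow> h \<in> carrier (G k)"
  using subgroup.subset[OF subgroup_H] by blast

lemma amal_rel_amal_word:
  assumes "amal_rel G H u v"
  shows "amal_word G u \<and> amal_word G v"
  using assms
proof (induction rule: amal_rel.induct)
  case (mult g k h)
  interpret group "G k" by (rule group_G)
  show ?case using mult by simp
next
  case (unit k)
  interpret group "G k" by (rule group_G)
  show ?case by simp
qed (auto simp: H_carrier)

lemma amal_rel_append:
  assumes "amal_rel G H u u'" "amal_rel G H v v'"
  shows "amal_rel G H (u @ v) (u' @ v')"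
proof -
  have "amal_rel G H (u @ v) (u' @ v)"
    using amal_rel.cong[OF assms(1), of "[]" v] amal_rel_amal_word[OF assms(2)] by simp
  moreover have "amal_rel G H (u' @ v) (u' @ v')"
    using amal_rel.cong[OF assms(2), of u' "[]"] amal_rel_amal_word[OF assms(1)] by simp
  ultimately show ?thesis by (rule amal_rel.trans)
qed

lemma amal_class_eq_iff:
  assumes "amal_word G u"
  shows "amal_class G H u = amal_class G H v \<longleftrightarrow> amal_rel G H u v"
  unfolding amal_class_def
  using amal_rel.refl[OF assms] amal_rel.sym amal_rel.trans by blast

lemma some_amal_class:
  assumes "amal_word G u"
  shows "amal_rel G H u (SOME a. a \<in> amal_class G H u)"
  using someI[of "\<lambda>a. a \<in> amal_class G H u" u] amal_rel.refl[OF assms]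
  by (simp add: amal_class_def)

text \<open>The product in \<open>amalgam\<close> is formed from chosen representatives;
  compatibility of \<open>amal_rel\<close> with concatenation makes the choice immaterial.\<close>

lemma mult_amal_class:
  assumes "amal_word G u" "amal_word G v"
  shows "amal_class G H u \<otimes>\<^bsub>amalgam G H\<^esub> amal_class G H v = amal_class G H (u @ v)"
proof -
  have "amal_rel G H (u @ v)
      ((SOME a. a \<in> amal_class G H u) @ (SOME b. b \<in> amal_class G H v))"
    using assms by (intro amal_rel_append some_amal_class)
  then have "amal_class G H (u @ v)
      = amal_class G H ((SOME a. a \<in> amal_class G H u) @ (SOME b. b \<in> amal_class G H v))"
    using assms by (simp add: amal_class_eq_iff)
  then show ?thesis by (simp add: amalgam_def)
qed

lemma carrier_amalgam: "carrier (amalgam G H) = {amal_class G H w | w. amal_word G w}"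
  by (simp add: amalgam_def)

lemma one_amalgam: "\<one>\<^bsub>amalgam G H\<^esub> = amal_class G H []"
  by (simp add: amalgam_def)

lemma amal_rel_left_inverse:
  assumes "amal_word G w"
  shows "\<exists>v. amal_word G v \<and> amal_rel G H (v @ w) []"
  using assms
proof (induction w)
  case Nil
  then show ?case using amal_rel.refl[of G "[]"] by (intro exI[of _ "[]"]) simp
next
  case (Cons p w)
  obtain k g where p: "p = (k, g)" by fastforce
  interpret group "G k" by (rule group_G)
  have g: "g \<in> carrier (G k)" and w: "amal_word G w" using Cons.prems p by auto
  obtain v where v: "amal_word G v" "amal_rel G H (v @ w) []" using Cons.IH[OF w] by blast
  have "amal_rel G H [(k, inv\<^bsub>G k\<^esub> g), (k, g)] [(k, \<one>\<^bsub>G k\<^esub>)]"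
    using amal_rel.mult[of "inv\<^bsub>G k\<^esub> g" G k g H] g by simp
  then have "amal_rel G H [(k, inv\<^bsub>G k\<^esub> g), (k, g)] []"
    using amal_rel.unit amal_rel.trans by blast
  from amal_rel.cong[OF this v(1) w]
  have "amal_rel G H ((v @ [(k, inv\<^bsub>G k\<^esub> g)]) @ p # w) (v @ w)" by (simp add: p)
  then have "amal_rel G H ((v @ [(k, inv\<^bsub>G k\<^esub> g)]) @ p # w) []"
    using v(2) by (rule amal_rel.trans)
  then show ?case using v(1) g by (intro exI[of _ "v @ [(k, inv\<^bsub>G k\<^esub> g)]"]) simp
qed

lemma group_amalgam: "group (amalgam G H)"
proof (rule groupI)
  fix x assume "x \<in> carrier (amalgam G H)"
  then obtain w where w: "x = amal_class G H w" "amal_word G w" by (auto simp: carrier_amalgam)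
  then obtain v where v: "amal_word G v" "amal_rel G H (v @ w) []"
    using amal_rel_left_inverse by blast
  then have "amal_class G H v \<otimes>\<^bsub>amalgam G H\<^esub> x = \<one>\<^bsub>amalgam G H\<^esub>"
    using w by (simp add: mult_amal_class one_amalgam amal_class_eq_iff)
  then show "\<exists>y\<in>carrier (amalgam G H). y \<otimes>\<^bsub>amalgam G H\<^esub> x = \<one>\<^bsub>amalgam G H\<^esub>"
    using v(1) carrier_amalgam by blast
next
  fix x y assume "x \<in> carrier (amalgam G H)" "y \<in> carrier (amalgam G H)"
  then show "x \<otimes>\<^bsub>amalgam G H\<^esub> y \<in> carrier (amalgam G H)"
    using amal_word_simps(3) by (auto simp: carrier_amalgam mult_amal_class)
next
  show "\<one>\<^bsub>amalgam G H\<^esub> \<in> carrier (amalgam G H)"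
    using amal_word_simps(1) by (auto simp: carrier_amalgam one_amalgam)
next
  fix x y z assume "x \<in> carrier (amalgam G H)" "y \<in> carrier (amalgam G H)" "z \<in> carrier (amalgam G H)"
  then show "x \<otimes>\<^bsub>amalgam G H\<^esub> y \<otimes>\<^bsub>amalgam G H\<^esub> z = x \<otimes>\<^bsub>amalgam G H\<^esub> (y \<otimes>\<^bsub>amalgam G H\<^esub> z)"
    by (auto simp: carrier_amalgam mult_amal_class)
next
  fix x assume "x \<in> carrier (amalgam G H)"
  then show "\<one>\<^bsub>amalgam G H\<^esub> \<otimes>\<^bsub>amalgam G H\<^esub> x = x"
    by (auto simp: carrier_amalgam mult_amal_class one_amalgam)
qed

text \<open>Two neighbours from the same factor can be multiplied. A letter from \<open>H\<close>
  with a neighbour can be moved to the factor of that neighbour and then multiplied with it. Both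
  shorten the word, so in a shortest word a letter from \<open>H\<close> can only stand
  alone.\<close>

lemma shortest_word_reduced:
  assumes w: "amal_word G w" and shortest: "\<And>v. amal_rel G H w v \<Longrightarrow> length w \<le> length v"
    and nontrivial: "\<not> amal_rel G H w []"
  shows "reduced_word H w \<or> (\<exists>k h. w = [(k, h)] \<and> h \<in> H \<and> h \<noteq> \<one>\<^bsub>G k\<^esub>)"
proof -
  have no_merge: False
    if "w = x @ [(k, g), (k', g')] @ y" and "amal_rel G H [(k, g), (k', g')] [(l, f)]" for x y k g k' g' l f
  proof -
    have "amal_rel G H w (x @ [(l, f)] @ y)"
      unfolding that(1) using w that by (intro amal_rel.cong) auto
    from shortest[OF this] show False using that(1) by simp
  qed
  have adj: "distinct_adj (map fst w)"
  proof (rule ccontr)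
    assume "\<not> distinct_adj (map fst w)"
    then obtain ys k zs where "map fst w = ys @ k # k # zs" by (rule not_distinct_adj_decomp)
    then obtain x g h y where eq: "w = x @ [(k, g), (k, h)] @ y"
      by (auto simp: map_eq_append_conv map_eq_Cons_conv)
    then have "g \<in> carrier (G k)" "h \<in> carrier (G k)" using w by auto
    then have "amal_rel G H [(k, g), (k, h)] [(k, g \<otimes>\<^bsub>G k\<^esub> h)]" by (rule amal_rel.mult)
    then show False by (rule no_merge[OF eq])
  qed
  show ?thesis
  proof (cases "\<exists>(k, h) \<in> set w. h \<in> H")
    case False
    moreover have "w \<noteq> []" using nontrivial amal_rel.refl[OF w] by auto
    ultimately show ?thesis using adj by (auto simp: reduced_word_def)
  next
    case True
    then obtain k h where kh: "(k, h) \<in> set w" "h \<in> H" by auto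
    then obtain x y where eq: "w = x @ (k, h) # y" by (meson split_list)
    have "y = []"
    proof (rule ccontr)
      assume "y \<noteq> []"
      then obtain l g y' where y: "y = (l, g) # y'" by (cases y) auto
      have g: "g \<in> carrier (G l)" using w eq y by auto
      have "amal_rel G H ([(k, h)] @ [(l, g)]) ([(l, h)] @ [(l, g)])"
        using kh(2) g by (intro amal_rel_append amal_rel.amalg amal_rel.refl) auto
      then have "amal_rel G H [(k, h), (l, g)] [(l, h \<otimes>\<^bsub>G l\<^esub> g)]"
        using amal_rel.trans[OF _ amal_rel.mult[of h G l g H, OF H_carrier[OF kh(2)] g]] by simp
      then show False using no_merge[of x k h l g y'] eq y by simp
    qed
    moreover have "x = []"
    proof (rule ccontr)
      assume "x \<noteq> []"
      then obtain x' l g where x: "x = x' @ [(l, g)]" by (cases x rule: rev_cases) auto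
      have g: "g \<in> carrier (G l)" using w eq x by auto
      have "amal_rel G H ([(l, g)] @ [(k, h)]) ([(l, g)] @ [(l, h)])"
        using kh(2) g by (intro amal_rel_append amal_rel.amalg amal_rel.refl) auto
      then have "amal_rel G H [(l, g), (k, h)] [(l, g \<otimes>\<^bsub>G l\<^esub> h)]"
        using amal_rel.trans[OF _ amal_rel.mult[of g G l h H, OF g H_carrier[OF kh(2)]]] by simp
      then show False using no_merge[of x' l g k h y] eq x by simp
    qed
    ultimately have "w = [(k, h)]" using eq by simp
    moreover have "h \<noteq> \<one>\<^bsub>G k\<^esub>" using nontrivial \<open>w = [(k, h)]\<close> amal_rel.unit by auto
    ultimately show ?thesis using kh(2) by blast
  qed
qed

text \<open>Approximate versions of the rules \<open>mult\<close> and \<open>amalg\<close>, required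
  on a finite set of letters. Bijectivity is exact and holds for all elements, so that an error can
  be transported along any word.\<close>

definition amal_model :: "'z set \<Rightarrow> (nat \<Rightarrow> 'a \<Rightarrow> 'z \<Rightarrow> 'z) \<Rightarrow> (nat \<times> 'a) set \<Rightarrow> real \<Rightarrow> bool" where
  "amal_model Z \<theta> D \<delta> \<longleftrightarrow> finite Z
    \<and> (\<forall>k. \<forall>g\<in>carrier (G k). bij_betw (\<theta> k g) Z Z)
    \<and> (\<forall>k g h. (k, g) \<in> D \<longrightarrow> (k, h) \<in> D \<longrightarrow> freq Z (\<lambda>x. \<theta> k g (\<theta> k h x) \<noteq> \<theta> k (g \<otimes>\<^bsub>G k\<^esub> h) x) \<le> \<delta>)
    \<and> (\<forall>k k' h. (k, h) \<in> D \<longrightarrow> (k', h) \<in> D \<longrightarrow> h \<in> H \<longrightarrow> freq Z (\<lambda>x. \<theta> k h x \<noteq> \<theta> k' h x) \<le> \<delta>)"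

lemma amal_model_subset: "amal_model Z \<theta> D \<delta> \<Longrightarrow> D' \<subseteq> D \<Longrightarrow> amal_model Z \<theta> D' \<delta>"
  unfolding amal_model_def by blast

lemma bij_betw_eval_word:
  assumes "amal_model Z \<theta> D \<delta>" "amal_word G w"
  shows "bij_betw (eval_word \<theta> w) Z Z"
  using assms(2)
proof (induction w)
  case Nil
  then show ?case using bij_betw_id by (simp add: eval_word_def id_def)
next
  case (Cons p w)
  obtain k g where p: "p = (k, g)" by fastforce
  have "bij_betw (\<theta> k g \<circ> eval_word \<theta> w) Z Z"
    using Cons p assms(1) unfolding amal_model_def by (auto intro: bij_betw_trans)
  then show ?case unfolding p by (simp add: eval_word_def comp_def)
qed

text \<open>A derivation applies finitely many rules. \<open>D\<close> collects the letters at which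
  the rules \<open>mult\<close>, \<open>unit\<close> and \<open>amalg\<close> are applied, and
  \<open>C\<close> counts these applications. Both depend on the derivation alone and precede the
  choice of a model.\<close>

lemma amal_rel_eval_word:
  assumes "amal_rel G H u v"
  shows "\<exists>D C. finite D \<and> D \<subseteq> {(k, g). g \<in> carrier (G k)} \<and>
    (\<forall>(Z :: 'z set) \<theta> \<delta>. amal_model Z \<theta> D \<delta> \<longrightarrow>
      freq Z (\<lambda>x. eval_word \<theta> u x \<noteq> eval_word \<theta> v x) \<le> real C * \<delta>)"
  using assms
proof (induction rule: amal_rel.induct)
  case (refl w)
  show ?case by (rule exI[of _ "{}"], rule exI[of _ 0]) (simp add: freq_False)
next
  case (sym u v)
  then show ?case by (simp only: neq_commute)
next
  case (trans u v w)
  obtain D1 C1 where 1: "finite D1" "D1 \<subseteq> {(k, g). g \<in> carrier (G k)}"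
    "\<And>(Z :: 'z set) \<theta> \<delta>. amal_model Z \<theta> D1 \<delta> \<Longrightarrow>
      freq Z (\<lambda>x. eval_word \<theta> u x \<noteq> eval_word \<theta> v x) \<le> real C1 * \<delta>"
    using trans.IH(1) by blast
  obtain D2 C2 where 2: "finite D2" "D2 \<subseteq> {(k, g). g \<in> carrier (G k)}"
    "\<And>(Z :: 'z set) \<theta> \<delta>. amal_model Z \<theta> D2 \<delta> \<Longrightarrow>
      freq Z (\<lambda>x. eval_word \<theta> v x \<noteq> eval_word \<theta> w x) \<le> real C2 * \<delta>"
    using trans.IH(2) by blast
  have "freq Z (\<lambda>x. eval_word \<theta> u x \<noteq> eval_word \<theta> w x) \<le> real (C1 + C2) * \<delta>"
    if m: "amal_model Z \<theta> (D1 \<union> D2) \<delta>" for Z :: "'z set" and \<theta> \<delta>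
  proof -
    have Z: "finite Z" using m by (simp add: amal_model_def)
    have "freq Z (\<lambda>x. eval_word \<theta> u x \<noteq> eval_word \<theta> w x)
        \<le> freq Z (\<lambda>x. eval_word \<theta> u x \<noteq> eval_word \<theta> v x \<or> eval_word \<theta> v x \<noteq> eval_word \<theta> w x)"
      by (rule freq_mono[OF Z]) auto
    also have "\<dots> \<le> freq Z (\<lambda>x. eval_word \<theta> u x \<noteq> eval_word \<theta> v x)
        + freq Z (\<lambda>x. eval_word \<theta> v x \<noteq> eval_word \<theta> w x)" by (rule freq_disj[OF Z])
    also have "\<dots> \<le> real C1 * \<delta> + real C2 * \<delta>"
      using m by (intro add_mono 1(3) 2(3)) (auto elim: amal_model_subset)
    finally show ?thesis by (simp add: algebra_simps)
  qed
  then show ?case using 1(1,2) 2(1,2) by (intro exI[of _ "D1 \<union> D2"] exI[of _ "C1 + C2"]) auto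
next
  case (cong u v x y)
  obtain D C where D: "finite D" "D \<subseteq> {(k, g). g \<in> carrier (G k)}"
    and le: "\<And>(Z :: 'z set) \<theta> \<delta>. amal_model Z \<theta> D \<delta> \<Longrightarrow>
      freq Z (\<lambda>x. eval_word \<theta> u x \<noteq> eval_word \<theta> v x) \<le> real C * \<delta>"
    using cong.IH by blast
  have "freq Z (\<lambda>z. eval_word \<theta> (x @ u @ y) z \<noteq> eval_word \<theta> (x @ v @ y) z) \<le> real C * \<delta>"
    if m: "amal_model Z \<theta> D \<delta>" for Z :: "'z set" and \<theta> \<delta>
  proof -
    have "freq Z (\<lambda>z. eval_word \<theta> (x @ u @ y) z \<noteq> eval_word \<theta> (x @ v @ y) z)
        \<le> freq Z (\<lambda>z. eval_word \<theta> u (eval_word \<theta> y z) \<noteq> eval_word \<theta> v (eval_word \<theta> y z))"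
      using m by (intro freq_mono) (auto simp: amal_model_def)
    \<comment> \<open>The left context can only remove disagreements, and the right context is a
      bijective change of the starting point.\<close>
    also have "\<dots> = freq Z (\<lambda>z. eval_word \<theta> u z \<noteq> eval_word \<theta> v z)"
      by (rule freq_bij_betw[OF bij_betw_eval_word[OF m \<open>amal_word G y\<close>]])
    finally show ?thesis using le[OF m] by simp
  qed
  then show ?case using D by blast
next
  case (mult g k h)
  then show ?case
    by (intro exI[of _ "{(k, g), (k, h)}"] exI[of _ 1]) (simp add: amal_model_def)
next
  case (unit k)
  interpret group "G k" by (rule group_G)
  have "freq Z (\<lambda>x. \<theta> k \<one>\<^bsub>G k\<^esub> x \<noteq> x) \<le> \<delta>"
    if m: "amal_model Z \<theta> {(k, \<one>\<^bsub>G k\<^esub>)} \<delta>" for Z :: "'z set" and \<theta> \<delta>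
  proof -
    have bij: "bij_betw (\<theta> k \<one>\<^bsub>G k\<^esub>) Z Z" and Z: "finite Z"
      and le: "freq Z (\<lambda>x. \<theta> k \<one>\<^bsub>G k\<^esub> (\<theta> k \<one>\<^bsub>G k\<^esub> x) \<noteq> \<theta> k (\<one>\<^bsub>G k\<^esub> \<otimes>\<^bsub>G k\<^esub> \<one>\<^bsub>G k\<^esub>) x) \<le> \<delta>"
      using m unfolding amal_model_def by auto
    \<comment> \<open>The unit acts almost trivially because it is almost idempotent and injective:
      where its square agrees with it, it fixes the point.\<close>
    have "freq Z (\<lambda>x. \<theta> k \<one>\<^bsub>G k\<^esub> x \<noteq> x) \<le> freq Z (\<lambda>x. \<theta> k \<one>\<^bsub>G k\<^esub> (\<theta> k \<one>\<^bsub>G k\<^esub> x) \<noteq> \<theta> k \<one>\<^bsub>G k\<^esub> x)"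
    proof (rule freq_mono[OF Z])
      fix x assume x: "x \<in> Z" "\<theta> k \<one>\<^bsub>G k\<^esub> x \<noteq> x"
      moreover have "\<theta> k \<one>\<^bsub>G k\<^esub> x \<in> Z" using bij x by (auto simp: bij_betw_def)
      ultimately show "\<theta> k \<one>\<^bsub>G k\<^esub> (\<theta> k \<one>\<^bsub>G k\<^esub> x) \<noteq> \<theta> k \<one>\<^bsub>G k\<^esub> x"
        using bij by (metis bij_betw_def inj_onD)
    qed
    then show ?thesis using le by simp
  qed
  then show ?case by (intro exI[of _ "{(k, \<one>\<^bsub>G k\<^esub>)}"] exI[of _ 1]) simp
next
  case (amalg h k k')
  then show ?case
    by (intro exI[of _ "{(k, h), (k', h)}"] exI[of _ 1]) (auto simp: amal_model_def H_carrier)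
qed

end

section \<open>The twisted product over a partition\<close>

context amalgamation
begin

text \<open>In the twisted product over a partition, each factor \<open>G k\<close> acts through its own
  conjugate \<open>T\<^sub>k \<alpha> T\<^sub>k\<close> of the base action, where the involution \<open>T\<^sub>k\<close> applies \<open>\<rho> (k, tile a)\<close> in
  the fibre over \<open>a\<close>. Elements that preserve the tiles commute with \<open>T\<^sub>k\<close>, which gives the
  amalgamation, while an alternating word spells out a word of free involutions in the fibre.\<close>

lemma amal_model_of_partition:
  fixes A :: "'p set" and \<alpha> :: "nat \<Rightarrow> 'a \<Rightarrow> 'p \<Rightarrow> 'p" and tile :: "'p \<Rightarrow> nat"
  assumes A: "finite A" "A \<noteq> {}"
    and bij: "\<And>k g. g \<in> carrier (G k) \<Longrightarrow> bij_betw (\<alpha> k g) A A"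
    and D: "finite D" "D \<subseteq> {(k, g). g \<in> carrier (G k)}" and \<epsilon>: "\<epsilon> \<ge> 0"
    and mul: "\<And>k g h. (k, g) \<in> D \<Longrightarrow> (k, h) \<in> D \<Longrightarrow>
      freq A (\<lambda>a. \<alpha> k (g \<otimes>\<^bsub>G k\<^esub> h) a \<noteq> \<alpha> k g (\<alpha> k h a)) \<le> \<epsilon>"
    and amal: "\<And>k k' h. (k, h) \<in> D \<Longrightarrow> (k', h) \<in> D \<Longrightarrow> h \<in> H \<Longrightarrow> \<alpha> k h = \<alpha> k' h"
    and free: "\<And>k g. (k, g) \<in> D \<Longrightarrow> g \<noteq> \<one>\<^bsub>G k\<^esub> \<Longrightarrow> freq A (\<lambda>a. \<alpha> k g a = a) \<le> \<epsilon>"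
    and tile: "\<And>k h. (k, h) \<in> D \<Longrightarrow> h \<in> H \<Longrightarrow> freq A (\<lambda>a. tile (\<alpha> k h a) \<noteq> tile a) \<le> \<epsilon>"
    and sep: "\<And>k g. (k, g) \<in> D \<Longrightarrow> g \<notin> H \<Longrightarrow> freq A (\<lambda>a. tile (\<alpha> k g a) = tile a) \<le> \<epsilon>"
    and \<delta>: "real (N + 1) * \<epsilon> \<le> \<delta>"
  obtains Z :: "('p \<times> ((nat \<times> nat) list \<Rightarrow> nat \<Rightarrow> nat)) set" and \<theta>
  where "Z \<noteq> {}" "amal_model Z \<theta> D \<delta>"
    "\<And>k g. (k, g) \<in> D \<Longrightarrow> g \<noteq> \<one>\<^bsub>G k\<^esub> \<Longrightarrow> freq Z (\<lambda>z. \<theta> k g z = z) \<le> \<delta>"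
    "\<And>w. set w \<subseteq> D \<Longrightarrow> length w \<le> N \<Longrightarrow> reduced_word H w \<Longrightarrow> freq Z (\<lambda>z. eval_word \<theta> w z = z) \<le> \<delta>"
proof -
  \<comment> \<open>The summand 1 in \<open>N + 1\<close> secures this bound also for
    \<open>N = 0\<close>.\<close>
  have \<epsilon>\<delta>: "\<epsilon> \<le> \<delta>" using \<delta> \<epsilon> by (simp add: algebra_simps) (smt (verit) mult_nonneg_nonneg of_nat_0_le_iff)
  \<comment> \<open>The alphabet of the free involutions: a factor index occurring in
    \<open>D\<close> and a tile. The length bound is doubled because each letter of a word of the
    amalgam applies two involutions.\<close>
  have "finite (fst ` D \<times> tile ` A)" using A D by auto
  then obtain C :: "((nat \<times> nat) list \<Rightarrow> nat \<Rightarrow> nat) set" and \<rho>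
    where C: "finite C" "C \<noteq> {}" and \<rho>C: "\<And>y c. c \<in> C \<Longrightarrow> \<rho> y c \<in> C"
      and \<rho>\<rho>: "\<And>y c. c \<in> C \<Longrightarrow> \<rho> y (\<rho> y c) = c"
      and \<rho>_free: "\<And>w c. set w \<subseteq> fst ` D \<times> tile ` A \<Longrightarrow> length w \<le> 2 * N \<Longrightarrow> w \<noteq> [] \<Longrightarrow>
        distinct_adj w \<Longrightarrow> c \<in> C \<Longrightarrow> foldr \<rho> w c \<noteq> c"
    by (rule ex_free_involutions[where N = "2 * N"]) blast
  define \<theta> where "\<theta> k g z = (\<alpha> k g (fst z), \<rho> (k, tile (\<alpha> k g (fst z))) (\<rho> (k, tile (fst z)) (snd z)))"
    for k g z
  have \<alpha>A: "\<alpha> k g a \<in> A" if "g \<in> carrier (G k)" "a \<in> A" for k g a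
    using bij[OF that(1)] that(2) by (auto simp: bij_betw_def)
  have Dc: "g \<in> carrier (G k)" if "(k, g) \<in> D" for k g using D that by auto
  define Z where "Z = A \<times> C"
  have Z: "finite Z" "Z \<noteq> {}" using A C unfolding Z_def by auto
  have lift: "freq Z (\<lambda>z. P (fst z)) = freq A P" for P
    unfolding Z_def by (rule freq_Times_fst[OF C])
  have bij\<theta>: "bij_betw (\<theta> k g) Z Z" if g: "g \<in> carrier (G k)" for k g
  proof -
    have "inj_on (\<theta> k g) Z"
    proof (rule inj_onI)
      fix z z' assume z: "z \<in> Z" "z' \<in> Z" and eq: "\<theta> k g z = \<theta> k g z'"
      have zA: "fst z \<in> A" "fst z' \<in> A" "snd z \<in> C" "snd z' \<in> C" using z unfolding Z_def by auto
      have 1: "fst z = fst z'"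
        using eq zA bij[OF g] unfolding \<theta>_def bij_betw_def by (auto dest: inj_onD)
      then have "\<rho> (k, tile (\<alpha> k g (fst z))) (\<rho> (k, tile (fst z)) (snd z))
          = \<rho> (k, tile (\<alpha> k g (fst z))) (\<rho> (k, tile (fst z)) (snd z'))"
        using eq unfolding \<theta>_def by simp
      then have "\<rho> (k, tile (fst z)) (snd z) = \<rho> (k, tile (fst z)) (snd z')"
        using \<rho>\<rho> \<rho>C zA by metis
      then have "snd z = snd z'" using \<rho>\<rho> zA by metis
      with 1 show "z = z'" by (rule prod_eqI)
    qed
    moreover have "\<theta> k g ` Z \<subseteq> Z" using \<alpha>A[OF g] \<rho>C unfolding \<theta>_def Z_def by auto
    ultimately show ?thesis using Z(1) by (simp add: bij_betw_def endo_inj_surj)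
  qed
  have model: "amal_model Z \<theta> D \<delta>"
    unfolding amal_model_def
  proof (intro conjI allI impI ballI)
    fix k g h assume gh: "(k, g) \<in> D" "(k, h) \<in> D"
    \<comment> \<open>The involution at the intermediate tile is applied twice and cancels, so
      multiplicativity fails only where the base action fails.\<close>
    have "freq Z (\<lambda>z. \<theta> k g (\<theta> k h z) \<noteq> \<theta> k (g \<otimes>\<^bsub>G k\<^esub> h) z)
        \<le> freq Z (\<lambda>z. \<alpha> k (g \<otimes>\<^bsub>G k\<^esub> h) (fst z) \<noteq> \<alpha> k g (\<alpha> k h (fst z)))"
      by (rule freq_mono[OF Z(1)]) (auto simp: \<theta>_def Z_def \<rho>\<rho> \<rho>C)
    also have "\<dots> = freq A (\<lambda>a. \<alpha> k (g \<otimes>\<^bsub>G k\<^esub> h) a \<noteq> \<alpha> k g (\<alpha> k h a))"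
      by (rule lift)
    finally show "freq Z (\<lambda>z. \<theta> k g (\<theta> k h z) \<noteq> \<theta> k (g \<otimes>\<^bsub>G k\<^esub> h) z) \<le> \<delta>"
      using mul[OF gh] \<epsilon>\<delta> by simp
  next
    fix k k' h assume h: "(k, h) \<in> D" "(k', h) \<in> D" "h \<in> H"
    \<comment> \<open>Where the tile is preserved, both involutions are the same and cancel. There
      \<open>\<theta> k h\<close> acts on the base alone, in a way that does not depend on
      \<open>k\<close>.\<close>
    have "freq Z (\<lambda>z. \<theta> k h z \<noteq> \<theta> k' h z) \<le> freq Z (\<lambda>z. tile (\<alpha> k h (fst z)) \<noteq> tile (fst z))"
    proof (rule freq_mono[OF Z(1)])
      fix z assume z: "z \<in> Z" "\<theta> k h z \<noteq> \<theta> k' h z"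
      then show "tile (\<alpha> k h (fst z)) \<noteq> tile (fst z)"
        using \<rho>\<rho>[of "snd z"] unfolding \<theta>_def amal[OF h] Z_def by auto
    qed
    also have "\<dots> = freq A (\<lambda>a. tile (\<alpha> k h a) \<noteq> tile a)" by (rule lift)
    finally show "freq Z (\<lambda>z. \<theta> k h z \<noteq> \<theta> k' h z) \<le> \<delta>"
      using tile[OF h(1,3)] \<epsilon>\<delta> by simp
  qed (use Z bij\<theta> in auto)
  have free': "freq Z (\<lambda>z. \<theta> k g z = z) \<le> \<delta>" if g: "(k, g) \<in> D" "g \<noteq> \<one>\<^bsub>G k\<^esub>" for k g
  proof -
    have "freq Z (\<lambda>z. \<theta> k g z = z) \<le> freq Z (\<lambda>z. \<alpha> k g (fst z) = fst z)"
      by (rule freq_mono[OF Z(1)]) (auto simp: \<theta>_def prod_eq_iff)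
    also have "\<dots> = freq A (\<lambda>a. \<alpha> k g a = a)" by (rule lift)
    finally show ?thesis using free[OF g] \<epsilon>\<delta> by simp
  qed
  \<comment> \<open>The word of involutions that \<open>w\<close> applies in the fibre when it
    starts over \<open>a\<close>. Each letter contributes first the tile it leaves and then the tile
    it reaches; they appear in the opposite order because \<open>foldr\<close> reads from the
    right.\<close>
  define letters where "letters = rec_list (\<lambda>a. []) (\<lambda>p w r a. (fst p, tile (\<alpha> (fst p) (snd p) (eval_word \<alpha> w a)))
      # (fst p, tile (eval_word \<alpha> w a)) # r a)"
  have letters: "letters [] a = []"
    "letters ((k, g) # w) a = (k, tile (\<alpha> k g (eval_word \<alpha> w a))) # (k, tile (eval_word \<alpha> w a)) # letters w a"
    for a k g w by (simp_all add: letters_def)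
  \<comment> \<open>The walk of \<open>w\<close> from \<open>a\<close> has some step that stays in
    its tile, so that two involutions would cancel.\<close>
  define bad where "bad = rec_list (\<lambda>a. False) (\<lambda>p w r a.
      tile (\<alpha> (fst p) (snd p) (eval_word \<alpha> w a)) = tile (eval_word \<alpha> w a) \<or> r a)"
  have bad: "bad [] a = False"
    "bad ((k, g) # w) a = (tile (\<alpha> k g (eval_word \<alpha> w a)) = tile (eval_word \<alpha> w a) \<or> bad w a)"
    for a k g w by (simp_all add: bad_def)
  have bij_eval: "bij_betw (eval_word \<alpha> w) A A" if "set w \<subseteq> D" for w
    using that
  proof (induction w)
    case Nil
    then show ?case using bij_betw_id by (simp add: eval_word_def id_def)
  next
    case (Cons p w)
    obtain k g where p: "p = (k, g)" by fastforce
    have "bij_betw (\<alpha> k g \<circ> eval_word \<alpha> w) A A"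
      using Cons p Dc by (intro bij_betw_trans[OF _ bij]) auto
    then show ?case unfolding p by (simp add: eval_word_def comp_def)
  qed
  have evA: "eval_word \<alpha> w a \<in> A" if "set w \<subseteq> D" "a \<in> A" for w a
    using bij_eval[OF that(1)] that(2) by (auto simp: bij_betw_def)
  have freq_bad: "freq A (bad w) \<le> real (length w) * \<epsilon>" if "set w \<subseteq> D" "\<forall>(k, g)\<in>set w. g \<notin> H" for w
    using that
  proof (induction w)
    case Nil
    then show ?case by (simp add: bad freq_False)
  next
    case (Cons p w)
    obtain k g where p: "p = (k, g)" by fastforce
    have "freq A (bad (p # w))
        = freq A (\<lambda>a. tile (\<alpha> k g (eval_word \<alpha> w a)) = tile (eval_word \<alpha> w a) \<or> bad w a)"
      by (intro freq_cong) (simp add: p bad)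
    also have "\<dots> \<le> freq A (\<lambda>a. tile (\<alpha> k g (eval_word \<alpha> w a)) = tile (eval_word \<alpha> w a)) + freq A (bad w)"
      by (rule freq_disj[OF A(1)])
    \<comment> \<open>The suffix \<open>w\<close> acts bijectively on \<open>A\<close>, so the point
      it reaches is as uniformly distributed as the starting point.\<close>
    also have "freq A (\<lambda>a. tile (\<alpha> k g (eval_word \<alpha> w a)) = tile (eval_word \<alpha> w a))
        = freq A (\<lambda>a. tile (\<alpha> k g a) = tile a)"
      using Cons.prems by (intro freq_bij_betw bij_eval) auto
    also have "\<dots> \<le> \<epsilon>" using Cons.prems p by (intro sep) auto
    also have "freq A (bad w) \<le> real (length w) * \<epsilon>" using Cons by auto
    finally show ?case by (simp add: algebra_simps)
  qed
  have eval_\<theta>: "eval_word \<theta> w (a, c) = (eval_word \<alpha> w a, foldr \<rho> (letters w a) c)" for w a c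
    by (induction w) (auto simp: letters \<theta>_def)
  have letters_Y: "set (letters w a) \<subseteq> fst ` D \<times> tile ` A" if "set w \<subseteq> D" "a \<in> A" for w a
    using that(1)
  proof (induction w)
    case Nil
    then show ?case by (simp add: letters)
  next
    case (Cons p w)
    obtain k g where p: "p = (k, g)" by fastforce
    have "k \<in> fst ` D" using Cons.prems p by force
    moreover have "eval_word \<alpha> w a \<in> A" using evA Cons.prems that(2) by auto
    moreover have "\<alpha> k g (eval_word \<alpha> w a) \<in> A" using calculation(2) Cons.prems p Dc by (intro \<alpha>A) auto
    ultimately show ?case using Cons unfolding p letters by auto
  qed
  \<comment> \<open>Within the pair of one letter the tiles differ because the walk is not bad.
    Between neighbouring pairs the factor indices differ because the word alternates.\<close>
  have letters_adj: "distinct_adj (letters w a)" if "distinct_adj (map fst w)" "\<not> bad w a" for w a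
    using that
  proof (induction w)
    case Nil
    then show ?case by (simp add: letters)
  next
    case (Cons p w)
    obtain k g where p: "p = (k, g)" by fastforce
    have "distinct_adj (letters w a)" using Cons p by (auto simp: bad distinct_adj_Cons)
    moreover have "(k, tile (eval_word \<alpha> w a)) \<noteq> hd (letters w a)" if ne: "w \<noteq> []"
    proof -
      obtain k' g' w' where w: "w = (k', g') # w'" using ne by (cases w) auto
      then show ?thesis using Cons.prems(1) p by (simp add: letters)
    qed
    moreover have "letters w a = []" if "w = []" using that by (simp add: letters)
    ultimately show ?case using Cons.prems(2) unfolding p letters bad
      by (cases "w = []") (auto simp: distinct_adj_Cons)
  qed
  have red: "freq Z (\<lambda>z. eval_word \<theta> w z = z) \<le> \<delta>"
    if w: "set w \<subseteq> D" "length w \<le> N" "reduced_word H w" for w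
  proof -
    have len: "length (letters w a) = 2 * length w" for a
      by (induction w) (auto simp: letters)
    \<comment> \<open>Over a point that is not bad, the fibre coordinate is moved for every element
      of \<open>C\<close>, even if the base point returns.\<close>
    have "freq Z (\<lambda>z. eval_word \<theta> w z = z) \<le> freq Z (\<lambda>z. bad w (fst z))"
    proof (rule freq_mono[OF Z(1)], rule ccontr)
      fix z assume z: "z \<in> Z" "eval_word \<theta> w z = z" "\<not> bad w (fst z)"
      have zA: "fst z \<in> A" "snd z \<in> C" using z unfolding Z_def by auto
      have "foldr \<rho> (letters w (fst z)) (snd z) = snd z"
        using z(2) eval_\<theta>[of w "fst z" "snd z"] by (metis prod.collapse snd_conv)
      moreover have "letters w (fst z) \<noteq> []"
        using len[of "fst z"] w(3) by (auto simp: reduced_word_def)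
      ultimately show False
        using \<rho>_free[OF letters_Y[OF w(1) zA(1)] _ _ letters_adj zA(2)] len[of "fst z"] w(2,3) z(3)
        by (simp add: reduced_word_def)
    qed
    also have "\<dots> = freq A (bad w)" by (rule lift)
    also have "\<dots> \<le> real (length w) * \<epsilon>" using w by (intro freq_bad) (auto simp: reduced_word_def)
    also have "\<dots> \<le> real (N + 1) * \<epsilon>" using w(2) \<epsilon> by (intro mult_right_mono) auto
    finally show ?thesis using \<delta> by simp
  qed
  show ?thesis by (rule that[OF Z(2) model free' red])
qed

end

section \<open>Coordinates of an algebraic ultraproduct\<close>

lemma ultrafilter_ball:
  assumes U: "free_ultrafilter U" and "finite J" "\<And>j. j \<in> J \<Longrightarrow> {i. P i j} \<in> U"
  shows "{i. \<forall>j\<in>J. P i j} \<in> U"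
  using assms(2,3)
proof (induction J rule: finite_induct)
  case empty
  then show ?case using U by (simp add: free_ultrafilter_def)
next
  case (insert j J)
  have "{i. \<forall>j\<in>insert j J. P i j} = {i. P i j} \<inter> {i. \<forall>j\<in>J. P i j}" by auto
  then show ?case using U insert unfolding free_ultrafilter_def by simp
qed

lemma ultrafilter_conj:
  assumes "free_ultrafilter U" "{i. P i} \<in> U" "{i. Q i} \<in> U"
  shows "{i. P i \<and> Q i} \<in> U"
proof -
  have "{i. P i \<and> Q i} = {i. P i} \<inter> {i. Q i}" by auto
  then show ?thesis using assms unfolding free_ultrafilter_def by simp
qed

lemma ultrafilter_mono:
  assumes "free_ultrafilter U" "{i. P i} \<in> U" "\<And>i. P i \<Longrightarrow> Q i"
  shows "{i. Q i} \<in> U"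
  using assms unfolding free_ultrafilter_def by (metis Collect_mono)

lemma ultrafilter_not:
  assumes "free_ultrafilter U" "{i. P i} \<notin> U"
  shows "{i. \<not> P i} \<in> U"
  using assms unfolding free_ultrafilter_def by (metis Collect_neg_eq)

lemma normal_ultra_kernel:
  assumes U: "free_ultrafilter U" and M: "\<And>i. group (M i)"
  shows "ultra_kernel U M \<lhd> fullprod M"
proof -
  interpret P: group "fullprod M" using M by simp
  have one: "\<one>\<^bsub>M i\<^esub> \<in> carrier (M i)" for i using M by (simp add: group.is_monoid)
  have "subgroup (ultra_kernel U M) (fullprod M)"
  proof (rule P.subgroupI)
    show "ultra_kernel U M \<subseteq> carrier (fullprod M)" by (auto simp: ultra_kernel_def)
    have "\<one>\<^bsub>fullprod M\<^esub> \<in> ultra_kernel U M"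
      using U one by (auto simp: ultra_kernel_def free_ultrafilter_def)
    then show "ultra_kernel U M \<noteq> {}" by blast
  next
    fix x assume x: "x \<in> ultra_kernel U M"
    then have xP: "x \<in> carrier (fullprod M)" by (simp add: ultra_kernel_def)
    have inv: "inv\<^bsub>fullprod M\<^esub> x = (\<lambda>i. inv\<^bsub>M i\<^esub> x i)" using xP M by (simp add: restrict_def)
    have "{i. inv\<^bsub>M i\<^esub> x i = \<one>\<^bsub>M i\<^esub>} \<in> U"
    proof (rule ultrafilter_mono[OF U])
      show "{i. x i = \<one>\<^bsub>M i\<^esub>} \<in> U" using x by (simp add: ultra_kernel_def)
    qed (simp add: M group.is_monoid monoid.inv_one)
    then show "inv\<^bsub>fullprod M\<^esub> x \<in> ultra_kernel U M"
      using P.inv_closed[OF xP] unfolding ultra_kernel_def inv by simp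
  next
    fix x y assume x: "x \<in> ultra_kernel U M" and y: "y \<in> ultra_kernel U M"
    have "{i. x i = \<one>\<^bsub>M i\<^esub> \<and> y i = \<one>\<^bsub>M i\<^esub>} \<in> U"
      using x y by (intro ultrafilter_conj[OF U]) (auto simp: ultra_kernel_def)
    then have "{i. (x \<otimes>\<^bsub>fullprod M\<^esub> y) i = \<one>\<^bsub>M i\<^esub>} \<in> U"
      by (rule ultrafilter_mono[OF U]) (simp add: M group.is_monoid monoid.l_one one)
    then show "x \<otimes>\<^bsub>fullprod M\<^esub> y \<in> ultra_kernel U M"
      using x y P.m_closed[of x y] unfolding ultra_kernel_def by simp
  qed
  moreover have "x \<otimes>\<^bsub>fullprod M\<^esub> n \<otimes>\<^bsub>fullprod M\<^esub> inv\<^bsub>fullprod M\<^esub> x \<in> ultra_kernel U M"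
    if x: "x \<in> carrier (fullprod M)" and n: "n \<in> ultra_kernel U M" for x n
  proof -
    have nP: "n \<in> carrier (fullprod M)" using n by (simp add: ultra_kernel_def)
    have inv: "inv\<^bsub>fullprod M\<^esub> x = (\<lambda>i. inv\<^bsub>M i\<^esub> x i)" using x M by (simp add: restrict_def)
    have xi: "x i \<in> carrier (M i)" for i using x by auto
    have "{i. n i = \<one>\<^bsub>M i\<^esub>} \<in> U" using n by (simp add: ultra_kernel_def)
    then have "{i. (x \<otimes>\<^bsub>fullprod M\<^esub> n \<otimes>\<^bsub>fullprod M\<^esub> inv\<^bsub>fullprod M\<^esub> x) i = \<one>\<^bsub>M i\<^esub>} \<in> U"
      unfolding inv
      by (rule ultrafilter_mono[OF U]) (simp add: M group.is_monoid monoid.r_one group.r_inv xi)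
    then show ?thesis
      using P.m_closed[OF P.m_closed[OF x nP] P.inv_closed[OF x]] unfolding ultra_kernel_def by blast
  qed
  ultimately show ?thesis unfolding P.normal_inv_iff by blast
qed

text \<open>The case of Los's theorem for equations: the quotient of two sequences lies in the
  kernel exactly when they agree on a set of \<open>U\<close>.\<close>

lemma ultra_coset_eq_iff:
  assumes U: "free_ultrafilter U" and M: "\<And>i. group (M i)"
    and x: "x \<in> carrier (fullprod M)" and y: "y \<in> carrier (fullprod M)"
  shows "ultra_kernel U M #>\<^bsub>fullprod M\<^esub> x = ultra_kernel U M #>\<^bsub>fullprod M\<^esub> y
    \<longleftrightarrow> {i. x i = y i} \<in> U"
proof -
  interpret P: group "fullprod M" using M by simp
  interpret N: normal "ultra_kernel U M" "fullprod M" by (rule normal_ultra_kernel[OF U M])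
  have xi: "x i \<in> carrier (M i)" and yi: "y i \<in> carrier (M i)" for i using x y by auto
  have inv: "inv\<^bsub>fullprod M\<^esub> y = (\<lambda>i. inv\<^bsub>M i\<^esub> y i)" using y M by (simp add: restrict_def)
  have eq1: "x i \<otimes>\<^bsub>M i\<^esub> inv\<^bsub>M i\<^esub> y i = \<one>\<^bsub>M i\<^esub> \<longleftrightarrow> x i = y i" for i
    using group.inv_solve_right'[OF M, of "\<one>\<^bsub>M i\<^esub>" i "x i" "y i"] xi yi M
    by (simp add: group.is_monoid monoid.l_one)
  have "ultra_kernel U M #>\<^bsub>fullprod M\<^esub> x = ultra_kernel U M #>\<^bsub>fullprod M\<^esub> y
      \<longleftrightarrow> x \<otimes>\<^bsub>fullprod M\<^esub> inv\<^bsub>fullprod M\<^esub> y \<in> ultra_kernel U M"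
  proof
    assume "ultra_kernel U M #>\<^bsub>fullprod M\<^esub> x = ultra_kernel U M #>\<^bsub>fullprod M\<^esub> y"
    then have "x \<in> ultra_kernel U M #>\<^bsub>fullprod M\<^esub> y"
      using P.rcos_self[OF x N.subgroup_axioms] by blast
    then show "x \<otimes>\<^bsub>fullprod M\<^esub> inv\<^bsub>fullprod M\<^esub> y \<in> ultra_kernel U M"
      using N.rcos_module_imp[OF P.is_group y] by blast
  next
    assume "x \<otimes>\<^bsub>fullprod M\<^esub> inv\<^bsub>fullprod M\<^esub> y \<in> ultra_kernel U M"
    then have "x \<in> ultra_kernel U M #>\<^bsub>fullprod M\<^esub> y"
      using N.rcos_module_rev[OF P.is_group y x] by blast
    then show "ultra_kernel U M #>\<^bsub>fullprod M\<^esub> x = ultra_kernel U M #>\<^bsub>fullprod M\<^esub> y"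
      using P.repr_independence[OF _ y N.subgroup_axioms] by blast
  qed
  also have "\<dots> \<longleftrightarrow> {i. x i = y i} \<in> U"
    using P.m_closed[OF x P.inv_closed[OF y]] unfolding ultra_kernel_def inv by (simp add: eq1)
  finally show ?thesis .
qed

lemma ultra_coset_mult:
  assumes "free_ultrafilter U" "\<And>i. group (M i)"
    and "x \<in> carrier (fullprod M)" "y \<in> carrier (fullprod M)"
  shows "(ultra_kernel U M #>\<^bsub>fullprod M\<^esub> x) \<otimes>\<^bsub>ultraproduct U M\<^esub> (ultra_kernel U M #>\<^bsub>fullprod M\<^esub> y)
    = ultra_kernel U M #>\<^bsub>fullprod M\<^esub> (x \<otimes>\<^bsub>fullprod M\<^esub> y)"
  using normal.rcos_sum[OF normal_ultra_kernel[OF assms(1,2)] assms(3,4)]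
  by (simp add: ultraproduct_def FactGroup_def)

text \<open>By the defining properties of the ultraproduct, finitely many algebraic facts about the
  embeddings \<open>\<pi>\<^sub>k\<close> are witnessed in a single coordinate.\<close>

lemma (in amalgamation) consistently_relatively_sofic_coordinate:
  fixes K :: "'c monoid"
  assumes K: "sofic K" and rel: "consistently_relatively_sofic TYPE('b) G H K"
    and D: "finite D" "D \<subseteq> {(k, g). g \<in> carrier (G k)}"
  obtains L :: "'b monoid" and S and q
  where "sofic L" "subgroup S L" "amenable (L\<lparr>carrier := S\<rparr>)"
    "\<And>k g. g \<in> carrier (G k) \<Longrightarrow> q k g \<in> carrier (L \<times>\<times> K)"
    "\<And>k g h. (k, g) \<in> D \<Longrightarrow> (k, h) \<in> D \<Longrightarrow> q k (g \<otimes>\<^bsub>G k\<^esub> h) = q k g \<otimes>\<^bsub>L \<times>\<times> K\<^esub> q k h"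
    "\<And>k k' h. (k, h) \<in> D \<Longrightarrow> (k', h) \<in> D \<Longrightarrow> h \<in> H \<Longrightarrow> q k h = q k' h"
    "\<And>k g. (k, g) \<in> D \<Longrightarrow> q k g \<in> S \<times> carrier K \<longleftrightarrow> g \<in> H"
    "\<And>k g. (k, g) \<in> D \<Longrightarrow> g \<noteq> \<one>\<^bsub>G k\<^esub> \<Longrightarrow> q k g \<noteq> \<one>\<^bsub>L \<times>\<times> K\<^esub>"
proof -
  obtain L :: "nat \<Rightarrow> 'b monoid" and Hs U and \<pi> :: "nat \<Rightarrow> 'a \<Rightarrow> (nat \<Rightarrow> 'b \<times> 'c) set" where
    *: "(\<forall>i. sofic (L i) \<and> subgroup (Hs i) (L i) \<and> amenable ((L i)\<lparr>carrier := Hs i\<rparr>))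
     \<and> free_ultrafilter U
     \<and> (\<forall>k. \<pi> k \<in> hom (G k) (ultraproduct U (\<lambda>i. L i \<times>\<times> K)) \<and> inj_on (\<pi> k) (carrier (G k)))
     \<and> (\<forall>k. \<pi> k ` carrier (G k) \<inter> ultra_subproduct U (\<lambda>i. L i \<times>\<times> K) (\<lambda>i. Hs i \<times> carrier K) = \<pi> k ` H)
     \<and> (\<forall>h \<in> H. \<forall>k k'. \<pi> k h = \<pi> k' h)"
    using rel unfolding consistently_relatively_sofic_def by (elim exE) (rule that)
  note L = *[THEN conjunct1, rule_format]
    and U = *[THEN conjunct2, THEN conjunct1]
    and hom = *[THEN conjunct2, THEN conjunct2, THEN conjunct1, rule_format, THEN conjunct1]
    and inj = *[THEN conjunct2, THEN conjunct2, THEN conjunct1, rule_format, THEN conjunct2]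
    and meet = *[THEN conjunct2, THEN conjunct2, THEN conjunct2, THEN conjunct1, rule_format]
    and cons = *[THEN conjunct2, THEN conjunct2, THEN conjunct2, THEN conjunct2, rule_format]
  define M where "M i = L i \<times>\<times> K" for i
  define S where "S i = Hs i \<times> carrier K" for i
  have M: "group (M i)" for i
    unfolding M_def using L K by (intro DirProd_group) (auto simp: sofic_def)
  have oneM: "\<one>\<^bsub>M i\<^esub> \<in> carrier (M i)" for i using M by (simp add: group.is_monoid)
  have S1: "\<one>\<^bsub>M i\<^esub> \<in> S i" for i
    using L[of i] K unfolding M_def S_def by (auto simp: subgroup.one_closed sofic_def group.is_monoid)
  let ?N = "ultra_kernel U M" and ?P = "fullprod M"
  note hom = hom[folded M_def] and meet = meet[folded M_def S_def]
  interpret N: normal ?N ?P by (rule normal_ultra_kernel[OF U M])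
  \<comment> \<open>A sequence representing the coset \<open>\<pi> k g\<close>; identities between
    cosets become identities of coordinates on sets of \<open>U\<close>.\<close>
  define p where "p k g = (SOME x. x \<in> carrier ?P \<and> \<pi> k g = ?N #>\<^bsub>?P\<^esub> x)" for k g
  have "\<exists>x. x \<in> carrier ?P \<and> \<pi> k g = ?N #>\<^bsub>?P\<^esub> x" if "g \<in> carrier (G k)" for k g
    using hom_in_carrier[OF hom that] by (auto simp: ultraproduct_def FactGroup_def RCOSETS_def)
  from someI_ex[OF this] have "p k g \<in> carrier ?P \<and> \<pi> k g = ?N #>\<^bsub>?P\<^esub> p k g"
    if "g \<in> carrier (G k)" for k g using that unfolding p_def .
  then have pP: "p k g \<in> carrier ?P" and p: "\<pi> k g = ?N #>\<^bsub>?P\<^esub> p k g"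
    if "g \<in> carrier (G k)" for k g using that by blast+
  have eqU: "{i. p k g i = p k' g' i} \<in> U \<longleftrightarrow> \<pi> k g = \<pi> k' g'"
    if "g \<in> carrier (G k)" "g' \<in> carrier (G k')" for k k' g g'
    using ultra_coset_eq_iff[OF U M pP[OF that(1)] pP[OF that(2)]] p that by simp
  have mulU: "{i. p k (g \<otimes>\<^bsub>G k\<^esub> h) i = p k g i \<otimes>\<^bsub>M i\<^esub> p k h i} \<in> U"
    if "g \<in> carrier (G k)" "h \<in> carrier (G k)" for k g h
  proof -
    interpret group "G k" by (rule group_G)
    have "?N #>\<^bsub>?P\<^esub> p k (g \<otimes>\<^bsub>G k\<^esub> h) = ?N #>\<^bsub>?P\<^esub> (p k g \<otimes>\<^bsub>?P\<^esub> p k h)"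
      using hom_mult[OF hom that] that p ultra_coset_mult[OF U M pP[OF that(1)] pP[OF that(2)]]
      by simp
    moreover have "p k g \<otimes>\<^bsub>?P\<^esub> p k h \<in> carrier ?P"
      using pP that by (intro N.m_closed) auto
    ultimately show ?thesis
      using ultra_coset_eq_iff[OF U M pP, of "g \<otimes>\<^bsub>G k\<^esub> h" k "p k g \<otimes>\<^bsub>?P\<^esub> p k h"] that by simp
  qed
  have subU: "{i. p k g i \<in> S i \<longleftrightarrow> g \<in> H} \<in> U" if g: "g \<in> carrier (G k)" for k g
  proof (cases "g \<in> H")
    case True
    then have "\<pi> k g \<in> ultra_subproduct U M S" using meet by blast
    then obtain x where x: "x \<in> carrier ?P" "\<And>i. x i \<in> S i" "?N #>\<^bsub>?P\<^esub> x = \<pi> k g"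
      unfolding ultra_subproduct_def by blast
    then have "{i. x i = p k g i} \<in> U"
      using ultra_coset_eq_iff[OF U M x(1) pP[OF g]] p[OF g] by simp
    then show ?thesis by (rule ultrafilter_mono[OF U]) (metis True x(2))
  next
    case False
    have "{i. p k g i \<in> S i} \<notin> U"
    proof
      assume inS: "{i. p k g i \<in> S i} \<in> U"
      \<comment> \<open>Setting the coordinates outside \<open>S i\<close> to the unit changes the
        sequence off a set of \<open>U\<close> only, so the same coset lies in the subproduct. The
        intersection condition and injectivity of \<open>\<pi> k\<close> then put \<open>g\<close>
        into \<open>H\<close>.\<close>
      define x where "x i = (if p k g i \<in> S i then p k g i else \<one>\<^bsub>M i\<^esub>)" for i
      have x: "x \<in> carrier ?P" "\<And>i. x i \<in> S i" using pP[OF g] S1 oneM unfolding x_def by auto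
      have "{i. x i = p k g i} \<in> U" by (rule ultrafilter_mono[OF U inS]) (simp add: x_def)
      then have "?N #>\<^bsub>?P\<^esub> x = \<pi> k g" using ultra_coset_eq_iff[OF U M x(1) pP[OF g]] p[OF g] by simp
      then have "\<pi> k g \<in> ultra_subproduct U M S" using x unfolding ultra_subproduct_def by blast
      then obtain h where "h \<in> H" "\<pi> k g = \<pi> k h" using meet[of k] g by blast
      then show False using False inj_onD[OF inj] g H_carrier by metis
    qed
    from ultrafilter_not[OF U this] show ?thesis by (rule ultrafilter_mono[OF U]) (simp add: False)
  qed
  have oneU: "{i. g \<noteq> \<one>\<^bsub>G k\<^esub> \<longrightarrow> p k g i \<noteq> \<one>\<^bsub>M i\<^esub>} \<in> U" if g: "g \<in> carrier (G k)" for k g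
  proof (cases "g = \<one>\<^bsub>G k\<^esub>")
    case True
    then show ?thesis using U by (simp add: free_ultrafilter_def)
  next
    case False
    interpret group "G k" by (rule group_G)
    \<comment> \<open>If the coordinates were trivial on a set of \<open>U\<close>, then
      \<open>g\<close> and its square would have the same image under \<open>\<pi> k\<close>.
      Injectivity would make \<open>g\<close> idempotent, hence the unit.\<close>
    have "{i. p k g i = \<one>\<^bsub>M i\<^esub>} \<notin> U"
    proof
      assume "{i. p k g i = \<one>\<^bsub>M i\<^esub>} \<in> U"
      moreover have "{i. p k (g \<otimes>\<^bsub>G k\<^esub> g) i = p k g i \<otimes>\<^bsub>M i\<^esub> p k g i} \<in> U" using mulU g by blast
      ultimately have "{i. p k g i = \<one>\<^bsub>M i\<^esub> \<and> p k (g \<otimes>\<^bsub>G k\<^esub> g) i = p k g i \<otimes>\<^bsub>M i\<^esub> p k g i} \<in> U"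
        by (rule ultrafilter_conj[OF U])
      then have "{i. p k (g \<otimes>\<^bsub>G k\<^esub> g) i = p k g i} \<in> U"
        by (rule ultrafilter_mono[OF U]) (simp add: M group.is_monoid monoid.l_one oneM)
      then have "\<pi> k (g \<otimes>\<^bsub>G k\<^esub> g) = \<pi> k g" using eqU g by simp
      then have "g \<otimes>\<^bsub>G k\<^esub> g = g" using inj_onD[OF inj] g by simp
      then show False using False g by simp
    qed
    from ultrafilter_not[OF U this] show ?thesis by (rule ultrafilter_mono[OF U]) simp
  qed
  \<comment> \<open>All requirements on a pair of letters at coordinate \<open>i\<close>. Only
    finitely many pairs arise from \<open>D\<close>, so a single coordinate serves all of
    them.\<close>
  define Q where "Q i d e \<longleftrightarrow>
      (fst d = fst e \<longrightarrow> p (fst d) (snd d \<otimes>\<^bsub>G (fst d)\<^esub> snd e) i = p (fst d) (snd d) i \<otimes>\<^bsub>M i\<^esub> p (fst d) (snd e) i)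
    \<and> (snd d = snd e \<and> snd d \<in> H \<longrightarrow> p (fst d) (snd d) i = p (fst e) (snd d) i)
    \<and> (p (fst d) (snd d) i \<in> S i \<longleftrightarrow> snd d \<in> H)
    \<and> (snd d \<noteq> \<one>\<^bsub>G (fst d)\<^esub> \<longrightarrow> p (fst d) (snd d) i \<noteq> \<one>\<^bsub>M i\<^esub>)" for i d e
  have "{i. Q i d e} \<in> U" if "d \<in> D" "e \<in> D" for d e
  proof -
    have c: "snd d \<in> carrier (G (fst d))" "snd e \<in> carrier (G (fst e))" using that D by auto
    have "{i. fst d = fst e \<longrightarrow>
        p (fst d) (snd d \<otimes>\<^bsub>G (fst d)\<^esub> snd e) i = p (fst d) (snd d) i \<otimes>\<^bsub>M i\<^esub> p (fst d) (snd e) i} \<in> U"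
      using mulU[of "snd d" "fst d" "snd e"] c U by (cases "fst d = fst e") (auto simp: free_ultrafilter_def)
    moreover have "{i. snd d = snd e \<and> snd d \<in> H \<longrightarrow> p (fst d) (snd d) i = p (fst e) (snd d) i} \<in> U"
    proof (cases "snd d = snd e \<and> snd d \<in> H")
      case True
      then have "\<pi> (fst d) (snd d) = \<pi> (fst e) (snd d)" by (elim conjE) (rule cons)
      then have "{i. p (fst d) (snd d) i = p (fst e) (snd d) i} \<in> U"
        using eqU[of "snd d" "fst d" "snd d" "fst e"] c True by simp
      then show ?thesis by (rule ultrafilter_mono[OF U]) (intro impI)
    next
      case False
      then have "{i. snd d = snd e \<and> snd d \<in> H \<longrightarrow> p (fst d) (snd d) i = p (fst e) (snd d) i} = UNIV" by auto
      then show ?thesis using U by (simp add: free_ultrafilter_def)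
    qed
    ultimately show ?thesis
      unfolding Q_def by (intro ultrafilter_conj[OF U] subU oneU c)
  qed
  then have "{i. \<forall>d\<in>D. \<forall>e\<in>D. Q i d e} \<in> U"
    by (intro ultrafilter_ball[OF U D(1)]) auto
  then have "{i. \<forall>d\<in>D. \<forall>e\<in>D. Q i d e} \<noteq> {}" using U unfolding free_ultrafilter_def by metis
  then obtain i where i: "\<And>d e. d \<in> D \<Longrightarrow> e \<in> D \<Longrightarrow> Q i d e" by blast
  show ?thesis
  proof (rule that[of "L i" "Hs i" "\<lambda>k g. p k g i"])
    show "p k g i \<in> carrier (L i \<times>\<times> K)" if "g \<in> carrier (G k)" for k g
      using pP[OF that] unfolding M_def by auto
    show "p k (g \<otimes>\<^bsub>G k\<^esub> h) i = p k g i \<otimes>\<^bsub>L i \<times>\<times> K\<^esub> p k h i" if "(k, g) \<in> D" "(k, h) \<in> D" for k g h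
      using i[OF that] unfolding Q_def M_def by simp
    show "p k h i = p k' h i" if "(k, h) \<in> D" "(k', h) \<in> D" "h \<in> H" for k k' h
      using i[OF that(1,2)] that(3) unfolding Q_def by simp
    show "p k g i \<in> Hs i \<times> carrier K \<longleftrightarrow> g \<in> H" if "(k, g) \<in> D" for k g
      using i[OF that that] unfolding Q_def S_def by simp
    show "p k g i \<noteq> \<one>\<^bsub>L i \<times>\<times> K\<^esub>" if "(k, g) \<in> D" "g \<noteq> \<one>\<^bsub>G k\<^esub>" for k g
      using i[OF that(1,1)] that(2) unfolding Q_def M_def by simp
  qed (use L in auto)
qed

section \<open>Free approximate actions and soficity of the amalgam\<close>

lemma (in amalgamation) ex_free_amal_model:
  fixes K :: "'c monoid"
  assumes K: "sofic K" and rel: "consistently_relatively_sofic TYPE('b) G H K"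
    and D: "finite D" "D \<subseteq> {(k, g). g \<in> carrier (G k)}" and \<delta>: "\<delta> > 0"
  obtains Z :: "(((nat \<times> (nat \<Rightarrow> nat)) \<times> nat) \<times> ((nat \<times> nat) list \<Rightarrow> nat \<Rightarrow> nat)) set" and \<theta>
  where "Z \<noteq> {}" "amal_model Z \<theta> D \<delta>"
    "\<And>k g. (k, g) \<in> D \<Longrightarrow> g \<noteq> \<one>\<^bsub>G k\<^esub> \<Longrightarrow> freq Z (\<lambda>z. \<theta> k g z = z) \<le> \<delta>"
    "\<And>w. set w \<subseteq> D \<Longrightarrow> length w \<le> N \<Longrightarrow> reduced_word H w \<Longrightarrow> freq Z (\<lambda>z. eval_word \<theta> w z = z) \<le> \<delta>"
proof -
  obtain L :: "'b monoid" and S and q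
  where L: "sofic L" "subgroup S L" "amenable (L\<lparr>carrier := S\<rparr>)"
    and qc: "\<And>k g. g \<in> carrier (G k) \<Longrightarrow> q k g \<in> carrier (L \<times>\<times> K)"
    and qm: "\<And>k g h. (k, g) \<in> D \<Longrightarrow> (k, h) \<in> D \<Longrightarrow> q k (g \<otimes>\<^bsub>G k\<^esub> h) = q k g \<otimes>\<^bsub>L \<times>\<times> K\<^esub> q k h"
    and qa: "\<And>k k' h. (k, h) \<in> D \<Longrightarrow> (k', h) \<in> D \<Longrightarrow> h \<in> H \<Longrightarrow> q k h = q k' h"
    and qS: "\<And>k g. (k, g) \<in> D \<Longrightarrow> q k g \<in> S \<times> carrier K \<longleftrightarrow> g \<in> H"
    and q1: "\<And>k g. (k, g) \<in> D \<Longrightarrow> g \<noteq> \<one>\<^bsub>G k\<^esub> \<Longrightarrow> q k g \<noteq> \<one>\<^bsub>L \<times>\<times> K\<^esub>"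
    by (rule consistently_relatively_sofic_coordinate[OF K rel D]) blast
  \<comment> \<open>The base action is \<open>\<sigma>\<close> composed with \<open>q\<close>, so
    only images of letters in \<open>D\<close> matter. By \<open>qm\<close>, products of two such
    letters go to exact products in \<open>L \<times>\<times> K\<close>.\<close>
  define E where "E = (\<lambda>(k, g). q k g) ` D"
  have E: "finite E" "E \<subseteq> carrier (L \<times>\<times> K)"
    using D unfolding E_def by (auto intro!: qc simp del: carrier_DirProd)
  have qE: "q k g \<in> E" if "(k, g) \<in> D" for k g using that unfolding E_def by force
  define \<epsilon> where "\<epsilon> = \<delta> / real (N + 1)"
  have \<epsilon>: "\<epsilon> > 0" using \<delta> by (simp add: \<epsilon>_def)
  obtain A :: "((nat \<times> (nat \<Rightarrow> nat)) \<times> nat) set" and \<sigma> and tile :: "_ \<Rightarrow> nat"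
  where A: "finite A" "A \<noteq> {}" "\<And>g. g \<in> carrier (L \<times>\<times> K) \<Longrightarrow> bij_betw (\<sigma> g) A A"
    "\<And>g h. g \<in> E \<Longrightarrow> h \<in> E \<Longrightarrow> freq A (\<lambda>a. \<sigma> (g \<otimes>\<^bsub>L \<times>\<times> K\<^esub> h) a \<noteq> \<sigma> g (\<sigma> h a)) \<le> \<epsilon>"
    "\<And>g. g \<in> E \<Longrightarrow> g \<noteq> \<one>\<^bsub>L \<times>\<times> K\<^esub> \<Longrightarrow> freq A (\<lambda>a. \<sigma> g a = a) \<le> \<epsilon>"
    "\<And>h. h \<in> E \<Longrightarrow> h \<in> S \<times> carrier K \<Longrightarrow> freq A (\<lambda>a. tile (\<sigma> h a) \<noteq> tile a) \<le> \<epsilon>"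
    "\<And>g. g \<in> E \<Longrightarrow> g \<notin> S \<times> carrier K \<Longrightarrow> freq A (\<lambda>a. tile (\<sigma> g a) = tile a) \<le> \<epsilon>"
    by (rule sofic_amenable_partition_times[OF L K E \<epsilon>]) blast
  show ?thesis
  proof (rule amal_model_of_partition[where A = A and \<alpha> = "\<lambda>k g. \<sigma> (q k g)" and tile = tile
        and D = D and \<epsilon> = \<epsilon> and \<delta> = \<delta> and N = N])
    show "freq A (\<lambda>a. \<sigma> (q k (g \<otimes>\<^bsub>G k\<^esub> h)) a \<noteq> \<sigma> (q k g) (\<sigma> (q k h) a)) \<le> \<epsilon>"
      if "(k, g) \<in> D" "(k, h) \<in> D" for k g h
      unfolding qm[OF that] by (intro A(4) qE that)
    show "\<sigma> (q k h) = \<sigma> (q k' h)" if "(k, h) \<in> D" "(k', h) \<in> D" "h \<in> H" for k k' h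
      using qa[OF that] by simp
    show "real (N + 1) * \<epsilon> \<le> \<delta>" by (simp add: \<epsilon>_def)
    fix Z :: "(((nat \<times> (nat \<Rightarrow> nat)) \<times> nat) \<times> ((nat \<times> nat) list \<Rightarrow> nat \<Rightarrow> nat)) set" and \<theta>
    assume "Z \<noteq> {}" "amal_model Z \<theta> D \<delta>"
      "\<And>k g. (k, g) \<in> D \<Longrightarrow> g \<noteq> \<one>\<^bsub>G k\<^esub> \<Longrightarrow> freq Z (\<lambda>z. \<theta> k g z = z) \<le> \<delta>"
      "\<And>w. set w \<subseteq> D \<Longrightarrow> length w \<le> N \<Longrightarrow> reduced_word H w \<Longrightarrow> freq Z (\<lambda>z. eval_word \<theta> w z = z) \<le> \<delta>"
    then show thesis by (rule that)
  qed (use A D \<epsilon> qc qE qS q1 in auto)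
qed

text \<open>Representative words and the derivations for products in \<open>F\<close> are fixed
  first; they determine the letters, the length bound and the accuracy demanded of the model. Each
  element then acts by evaluating its representative.\<close>

theorem theorem2p11:
  fixes G :: "nat \<Rightarrow> 'a monoid" and H :: "'a set" and K :: "'c monoid"
  assumes "\<And>k. group (G k)"
    and "\<And>k. subgroup H (G k)"
    and "\<And>k k' x y. x \<in> H \<Longrightarrow> y \<in> H \<Longrightarrow> x \<otimes>\<^bsub>G k\<^esub> y = x \<otimes>\<^bsub>G k'\<^esub> y"
    and "sofic K"
    and "consistently_relatively_sofic TYPE('b) G H K"
  shows "sofic (amalgam G H)"
proof -
  interpret amalgamation G H using assms(1,2) by (rule amalgamation.intro)
  let ?\<Gamma> = "amalgam G H"
  \<comment> \<open>Shortest words are used as representatives because they are reduced or consist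
    of a single letter from \<open>H\<close>, and the model moves points in both cases.\<close>
  define shortest where "shortest \<gamma> w \<longleftrightarrow> amal_word G w \<and> \<gamma> = amal_class G H w
      \<and> (\<forall>v. amal_rel G H w v \<longrightarrow> length w \<le> length v)" for \<gamma> w
  have "\<exists>w. shortest \<gamma> w" if \<gamma>: "\<gamma> \<in> carrier ?\<Gamma>" for \<gamma>
  proof -
    obtain u where u: "amal_word G u" "\<gamma> = amal_class G H u" using \<gamma> by (auto simp: carrier_amalgam)
    obtain w where w: "amal_rel G H u w" "\<And>v. amal_rel G H u v \<Longrightarrow> length w \<le> length v"
      using ex_has_least_nat[of "amal_rel G H u" u length] amal_rel.refl[OF u(1), of H] by blast
    have "amal_word G w" using amal_rel_amal_word[OF w(1)] by blast
    moreover have "\<gamma> = amal_class G H w" using w(1) u by (simp add: amal_class_eq_iff)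
    ultimately show ?thesis using w amal_rel.trans unfolding shortest_def by blast
  qed
  then obtain rep where rep: "\<And>\<gamma>. \<gamma> \<in> carrier ?\<Gamma> \<Longrightarrow> shortest \<gamma> (rep \<gamma>)" by metis
  have rep_word: "amal_word G (rep \<gamma>)" and rep_class: "\<gamma> = amal_class G H (rep \<gamma>)"
    and rep_shortest: "\<And>v. amal_rel G H (rep \<gamma>) v \<Longrightarrow> length (rep \<gamma>) \<le> length v"
    if "\<gamma> \<in> carrier ?\<Gamma>" for \<gamma>
    using rep[OF that] unfolding shortest_def by blast+
  interpret \<Gamma>: group ?\<Gamma> by (rule group_amalgam)
  show ?thesis
  proof (rule soficI_finite_models[OF group_amalgam,
        where 'z = "((nat \<times> (nat \<Rightarrow> nat)) \<times> nat) \<times> ((nat \<times> nat) list \<Rightarrow> nat \<Rightarrow> nat)"])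
    fix F and \<epsilon> :: real
    assume F: "finite F" "F \<subseteq> carrier ?\<Gamma>" and \<epsilon>: "\<epsilon> > 0"
    have FC: "\<gamma> \<in> carrier ?\<Gamma>" if "\<gamma> \<in> F" for \<gamma> using F(2) that by blast
    have rel: "amal_rel G H (rep (\<gamma> \<otimes>\<^bsub>?\<Gamma>\<^esub> \<gamma>')) (rep \<gamma> @ rep \<gamma>')" if "\<gamma> \<in> F" "\<gamma>' \<in> F" for \<gamma> \<gamma>'
    proof -
      have c: "\<gamma> \<otimes>\<^bsub>?\<Gamma>\<^esub> \<gamma>' \<in> carrier ?\<Gamma>" using that FC by simp
      have "\<gamma> \<otimes>\<^bsub>?\<Gamma>\<^esub> \<gamma>' = amal_class G H (rep \<gamma> @ rep \<gamma>')"
        using mult_amal_class[OF rep_word rep_word] rep_class that FC by metis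
      then have "amal_class G H (rep (\<gamma> \<otimes>\<^bsub>?\<Gamma>\<^esub> \<gamma>')) = amal_class G H (rep \<gamma> @ rep \<gamma>')"
        using rep_class[OF c] by simp
      then show ?thesis using amal_class_eq_iff[OF rep_word[OF c]] by blast
    qed
    \<comment> \<open>Finite data \<open>D\<close> and \<open>C\<close> that bound the
      multiplicativity error of one pair in every model.\<close>
    define controls where "controls p D C \<longleftrightarrow> finite D \<and> D \<subseteq> {(k, g). g \<in> carrier (G k)} \<and>
        (\<forall>(Z :: (((nat \<times> (nat \<Rightarrow> nat)) \<times> nat) \<times> ((nat \<times> nat) list \<Rightarrow> nat \<Rightarrow> nat)) set) \<theta> \<delta>.
          amal_model Z \<theta> D \<delta> \<longrightarrow> freq Z (\<lambda>x. eval_word \<theta> (rep (fst p \<otimes>\<^bsub>?\<Gamma>\<^esub> snd p)) x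
            \<noteq> eval_word \<theta> (rep (fst p) @ rep (snd p)) x) \<le> real C * \<delta>)" for p D C
    have "\<exists>D C. controls p D C" if "p \<in> F \<times> F" for p
      unfolding controls_def using that by (intro amal_rel_eval_word rel) auto
    then obtain Dp Cp where DC: "\<And>p. p \<in> F \<times> F \<Longrightarrow> controls p (Dp p) (Cp p)" by metis
    have Dp: "finite (Dp p)" "Dp p \<subseteq> {(k, g). g \<in> carrier (G k)}" if "p \<in> F \<times> F" for p
      using DC[OF that] unfolding controls_def by blast+
    have Cp: "freq Z (\<lambda>x. eval_word \<theta> (rep (fst p \<otimes>\<^bsub>?\<Gamma>\<^esub> snd p)) x
          \<noteq> eval_word \<theta> (rep (fst p) @ rep (snd p)) x) \<le> real (Cp p) * \<delta>"
      if "p \<in> F \<times> F" "amal_model Z \<theta> (Dp p) \<delta>"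
      for p \<theta> \<delta> and Z :: "(((nat \<times> (nat \<Rightarrow> nat)) \<times> nat) \<times> ((nat \<times> nat) list \<Rightarrow> nat \<Rightarrow> nat)) set"
      using DC[OF that(1)] that(2) unfolding controls_def by blast
    \<comment> \<open>The first part controls multiplicativity, the second ensures that the
      representatives of elements of \<open>F\<close> are words over \<open>D\<close>, to which
      freeness applies.\<close>
    define D where "D = (\<Union>p\<in>F \<times> F. Dp p) \<union> (\<Union>\<gamma>\<in>F. set (rep \<gamma>))"
    have "set (rep \<gamma>) \<subseteq> {(k, g). g \<in> carrier (G k)}" if "\<gamma> \<in> F" for \<gamma>
      using rep_word[OF FC[OF that]] by (auto simp: amal_word_def)
    then have D: "finite D" "D \<subseteq> {(k, g). g \<in> carrier (G k)}"
      unfolding D_def using F(1) Dp by (simp, intro Un_least UN_least) simp_all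
    define c where "c = (\<Sum>p\<in>F \<times> F. Cp p)"
    define N where "N = (\<Sum>\<gamma>\<in>F. length (rep \<gamma>))"
    \<comment> \<open>Adding 2 makes both \<open>\<delta>\<close> and
      \<open>real c * \<delta>\<close> strictly smaller than \<open>\<epsilon>\<close>, also when
      \<open>c = 0\<close>.\<close>
    define \<delta> where "\<delta> = \<epsilon> / (real c + 2)"
    have \<delta>: "\<delta> > 0" "\<delta> < \<epsilon>" "real c * \<delta> < \<epsilon>"
      using \<epsilon> by (simp_all add: \<delta>_def field_simps add_pos_nonneg)
    obtain Z :: "(((nat \<times> (nat \<Rightarrow> nat)) \<times> nat) \<times> ((nat \<times> nat) list \<Rightarrow> nat \<Rightarrow> nat)) set" and \<theta>
      where Z: "Z \<noteq> {}" and model: "amal_model Z \<theta> D \<delta>"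
        and free: "\<And>k g. (k, g) \<in> D \<Longrightarrow> g \<noteq> \<one>\<^bsub>G k\<^esub> \<Longrightarrow> freq Z (\<lambda>z. \<theta> k g z = z) \<le> \<delta>"
        and red: "\<And>w. set w \<subseteq> D \<Longrightarrow> length w \<le> N \<Longrightarrow> reduced_word H w \<Longrightarrow>
          freq Z (\<lambda>z. eval_word \<theta> w z = z) \<le> \<delta>"
      by (rule ex_free_amal_model[OF assms(4,5) D \<delta>(1)]) blast
    have "freq Z (\<lambda>x. eval_word \<theta> (rep (\<gamma> \<otimes>\<^bsub>?\<Gamma>\<^esub> \<gamma>')) x \<noteq> eval_word \<theta> (rep \<gamma>) (eval_word \<theta> (rep \<gamma>') x)) < \<epsilon>"
      if "\<gamma> \<in> F" "\<gamma>' \<in> F" for \<gamma> \<gamma>'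
    proof -
      have p: "(\<gamma>, \<gamma>') \<in> F \<times> F" using that by simp
      have "Dp (\<gamma>, \<gamma>') \<subseteq> D" using p unfolding D_def by blast
      then have "freq Z (\<lambda>x. eval_word \<theta> (rep (\<gamma> \<otimes>\<^bsub>?\<Gamma>\<^esub> \<gamma>')) x \<noteq> eval_word \<theta> (rep \<gamma>) (eval_word \<theta> (rep \<gamma>') x))
          \<le> real (Cp (\<gamma>, \<gamma>')) * \<delta>"
        using Cp[OF p amal_model_subset[OF model]] by simp
      also have "\<dots> \<le> real c * \<delta>"
        using member_le_sum[OF p, of Cp] F(1) \<delta>(1) unfolding c_def by (intro mult_right_mono of_nat_mono) auto
      finally show ?thesis using \<delta>(3) by simp
    qed
    moreover have "freq Z (\<lambda>x. eval_word \<theta> (rep \<gamma>) x = x) < \<epsilon>" if \<gamma>: "\<gamma> \<in> F" "\<gamma> \<noteq> \<one>\<^bsub>?\<Gamma>\<^esub>" for \<gamma>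
    proof -
      have sub: "set (rep \<gamma>) \<subseteq> D" using \<gamma>(1) unfolding D_def by blast
      have len: "length (rep \<gamma>) \<le> N"
        unfolding N_def using member_le_sum[OF \<gamma>(1), of "\<lambda>\<gamma>. length (rep \<gamma>)"] F(1) by simp
      have "\<not> amal_rel G H (rep \<gamma>) []"
        using \<gamma> rep_class[OF FC[OF \<gamma>(1)]] amal_class_eq_iff[OF rep_word[OF FC[OF \<gamma>(1)]]]
        by (metis one_amalgam)
      from shortest_word_reduced[OF rep_word[OF FC[OF \<gamma>(1)]] rep_shortest[OF FC[OF \<gamma>(1)]] this]
      have "freq Z (\<lambda>x. eval_word \<theta> (rep \<gamma>) x = x) \<le> \<delta>"
      proof
        assume "reduced_word H (rep \<gamma>)"
        then show ?thesis by (rule red[OF sub len])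
      next
        assume "\<exists>k h. rep \<gamma> = [(k, h)] \<and> h \<in> H \<and> h \<noteq> \<one>\<^bsub>G k\<^esub>"
        then obtain k h where "rep \<gamma> = [(k, h)]" "h \<noteq> \<one>\<^bsub>G k\<^esub>" by blast
        then show ?thesis using free[of k h] sub by simp
      qed
      then show ?thesis using \<delta>(2) by simp
    qed
    moreover have "finite Z" using model by (simp add: amal_model_def)
    moreover have "bij_betw (eval_word \<theta> (rep \<gamma>)) Z Z" if "\<gamma> \<in> carrier ?\<Gamma>" for \<gamma>
      by (rule bij_betw_eval_word[OF model rep_word[OF that]])
    ultimately show "\<exists>(Z :: (((nat \<times> (nat \<Rightarrow> nat)) \<times> nat) \<times> ((nat \<times> nat) list \<Rightarrow> nat \<Rightarrow> nat)) set) \<phi>.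
        finite Z \<and> Z \<noteq> {} \<and> (\<forall>g\<in>carrier ?\<Gamma>. bij_betw (\<phi> g) Z Z)
        \<and> (\<forall>g\<in>F. \<forall>h\<in>F. freq Z (\<lambda>x. \<phi> (g \<otimes>\<^bsub>?\<Gamma>\<^esub> h) x \<noteq> \<phi> g (\<phi> h x)) < \<epsilon>)
        \<and> (\<forall>g\<in>F. g \<noteq> \<one>\<^bsub>?\<Gamma>\<^esub> \<longrightarrow> freq Z (\<lambda>x. \<phi> g x = x) < \<epsilon>)"
      using Z by (intro exI[of _ Z] exI[of _ "\<lambda>\<gamma>. eval_word \<theta> (rep \<gamma>)"]) blast
  qed
qed

end
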